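(* Let $n>-1$ and $0\leq \gamma<1$ be real numbers. Then the following inequalities hold for all $x>0$ (for real $\nu$ in the indicated range in each case): (1) $\displaystyle\int_0^x \mathrm{e}^{-\gamma t}t^\nu \mathbf{L}_{\nu+n}(t)\,\mathrm{d}t>\mathrm{e}^{-\gamma x}x^\nu \mathbf{L}_{\nu+n+1}(x)$, for $\nu>-\tfrac{1}{2}(n+2)$; (2) $\displaystyle\int_0^x t^{\nu}\mathbf{L}_{\nu}(t)\,\mathrm{d}t <x^{\nu}\mathbf{L}_{\nu}(x)$, for $\nu\geq \tfrac{1}{2}$; (3) $\displaystyle\int_0^x t^\nu \mathbf{L}_{\nu+n}(t)\,\mathrm{d}t<\frac{x^\nu}{2\nu+n+1}\bigg(2(\nu+n+1)\mathbf{L}_{\nu+n+1}(x)-(n+1)\mathbf{L}_{\nu+n+3}(x)-\frac{(n+1)x^{\nu+n+2}}{\sqrt{\pi}\,2^{\nu+n+1}(2\nu+n+2)\Gamma(\nu+n+\frac{5}{2})}\bigg)$, for $\nu>-\tfrac{1}{2}(n+1)$; (4) $\displaystyle\int_0^x\mathrm{e}^{-\gamma t} t^{\nu}\mathbf{L}_{\nu}(t)\,\mathrm{d}t \leq \frac{\mathrm{e}^{-\gamma x}}{1-\gamma}\int_0^xt^{\nu}\mathbf{L}_{\nu}(t)\,\mathrm{d}t$, for $\nu \geq \tfrac{1}{2}$; (5) $\displaystyle\int_0^x \mathrm{e}^{-\gamma t}t^{\nu}\mathbf{L}_\nu(t)\,\mathrm{d}t<\frac{\mathrm{e}^{-\gamma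 x}x^\nu}{(2\nu+1)(1-\gamma)}\bigg(2(\nu+1)\mathbf{L}_{\nu+1}(x)-\mathbf{L}_{\nu+3}(x)-\frac{x^{\nu+2}}{\sqrt{\pi}\,2^{\nu+2}(\nu+1)\Gamma(\nu+\frac{5}{2})}\bigg)$, for $\nu\geq\tfrac{1}{2}$; (6) $\displaystyle\int_0^x \mathrm{e}^{-\gamma t}t^{\nu+1} \mathbf{L}_{\nu}(t)\,\mathrm{d}t\geq\mathrm{e}^{-\gamma x}x^{\nu+1} \mathbf{L}_{\nu+1}(x)$, for $\nu>-\tfrac{3}{2}$; (7) $\displaystyle\int_0^x \mathrm{e}^{-\gamma t}t^{\nu+1} \mathbf{L}_{\nu}(t)\,\mathrm{d}t<\frac{1}{1-\gamma}\mathrm{e}^{-\gamma x}x^{\nu+1} \mathbf{L}_{\nu+1}(x)$, for $\nu>-\tfrac{1}{2}$. Equality holds in (4) and in (6) if and only if $\gamma=0$. The constants in the bounds (2)–(7) cannot be improved, and the constant in (1) is also best possible if $\gamma=0$. Inequalities (1) and (6) hold for all $\gamma>0$.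
   Context: For real $\nu$ and $x>0$, $\mathbf{L}_\nu$ denotes the modified Struve function of the first kind, $$\mathbf{L}_\nu(x)=\sum_{k=0}^\infty \frac{\big(\frac{1}{2}x\big)^{\nu+2k+1}}{\Gamma(k+\frac{3}{2})\,\Gamma(k+\nu+\frac{3}{2})},$$ where $1/\Gamma$ is taken to be $0$ at the poles of $\Gamma$. Convention on best possible constants: to say that the constant in a lower bound (resp. upper bound) "cannot be improved" or "is best possible" means that, for every fixed choice of the parameters $\nu,n,\gamma$ admissible for that bound, if its right-hand side is multiplied by a constant $c>1$ (resp. $0<c<1$), then the resulting inequality fails for some $x>0$.
   Formalization: Inequality (7) is proved with ≤ for 0≤γ<1 and with strict < for 0<γ<1, because at γ=0 its two sides are equal for every x>0 and the strict inequality as stated fails. *)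

theory Defs
  imports "HOL-Analysis.Analysis"
begin

text \<open>
  The modified Struve function of the first kind, for real order and \<open>x > 0\<close>.
  \<open>rGamma\<close> is the reciprocal Gamma function, which vanishes at the poles of \<open>Gamma\<close>.
\<close>

definition struve_L :: "real \<Rightarrow> real \<Rightarrow> real" where
  "struve_L \<nu> x =
     (\<Sum>k. (x / 2) powr (\<nu> + 2 * real k + 1) * rGamma (real k + 3 / 2) * rGamma (real k + \<nu> + 3 / 2))"

text \<open>
  Best possible constants, for a bound \<open>R (f x) (g x)\<close> valid for all \<open>x > 0\<close>. The relation \<open>R\<close>
  is the inequality sign of the bound: \<open>>\<close> or \<open>\<ge>\<close> for lower bounds, \<open><\<close> or \<open>\<le>\<close> for upper bounds.
\<close>

definition best_lower_constant ::
    "(real \<Rightarrow> real \<Rightarrow> bool) \<Rightarrow> (real \<Rightarrow> real) \<Rightarrow> (real \<Rightarrow> real) \<Rightarrow> bool" where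
  "best_lower_constant R f g \<longleftrightarrow> (\<forall>c>1. \<exists>x>0. \<not> R (f x) (c * g x))"

definition best_upper_constant ::
    "(real \<Rightarrow> real \<Rightarrow> bool) \<Rightarrow> (real \<Rightarrow> real) \<Rightarrow> (real \<Rightarrow> real) \<Rightarrow> bool" where
  "best_upper_constant R f g \<longleftrightarrow> (\<forall>c. 0 < c \<and> c < 1 \<longrightarrow> (\<exists>x>0. \<not> R (f x) (c * g x)))"

end

theory Submission
  imports Defs "HOL-Real_Asymp.Real_Asymp"
begin

text \<open>
  Up to a power of \<open>x\<close>, every function here is an entire even power series with positive
  coefficients. Bounds (1) and (3) without the exponential factor hold coefficientwise, and their
  constants are sharp because the ratio of the coefficients tends to \<open>1\<close>. For \<open>\<nu> \<ge> 1 / 2\<close> the Struve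
  equation gives \<open>f'' > f\<close> for \<open>f x = x powr \<nu> * struve_L \<nu> x\<close>, whence \<open>f' > f\<close> and (2).
  If \<open>g' > g\<close>, then \<open>exp (- \<gamma> * x) * g x - (1 - \<gamma>) * I x\<close> with \<open>I\<close> the integral of
  \<open>exp (- \<gamma> * t) * g' t\<close> has derivative \<open>\<gamma> * exp (- \<gamma> * x) * (g' x - g x)\<close>, which yields (4) and
  (7), and (5) combines (3) and (4). For (1) and (6) the weight \<open>exp (- \<gamma> * t)\<close> is bounded below
  by its value at \<open>x\<close>; this loses nothing as \<open>x\<close> tends to \<open>0\<close>, so the constant in (6) is sharp.
  A smaller constant \<open>c\<close> in (2), (4), (5) or (7) would force the integral to grow exponentially at
  too high a rate: in (7), \<open>I' \<ge> (1 - \<gamma>) / c * I\<close> although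
  \<open>I x = O(x powr q * exp ((1 - \<gamma>) * x))\<close>.
\<close>

section \<open>Even power series with a real power as prefactor\<close>

definition entire_coeffs :: "(nat \<Rightarrow> real) \<Rightarrow> bool" where
  "entire_coeffs a \<longleftrightarrow> (\<forall>y. summable (\<lambda>k. a k * y ^ k))"

text \<open>Since \<open>0 powr q = 0\<close> for every \<open>q\<close>, \<open>pser q a 0 = 0\<close> even when \<open>q \<le> 0\<close>.\<close>

definition pser :: "real \<Rightarrow> (nat \<Rightarrow> real) \<Rightarrow> real \<Rightarrow> real" where
  "pser q a x = x powr q * (\<Sum>k. a k * (x\<^sup>2) ^ k)"

lemma entire_coeffsD: "entire_coeffs a \<Longrightarrow> summable (\<lambda>k. a k * y ^ k)"
  by (simp add: entire_coeffs_def)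

lemma entire_coeffs_add:
  "entire_coeffs a \<Longrightarrow> entire_coeffs b \<Longrightarrow> entire_coeffs (\<lambda>k. a k + b k)"
  unfolding entire_coeffs_def by (auto simp: distrib_right intro: summable_add)

lemma entire_coeffs_diff:
  "entire_coeffs a \<Longrightarrow> entire_coeffs b \<Longrightarrow> entire_coeffs (\<lambda>k. a k - b k)"
  unfolding entire_coeffs_def by (auto simp: left_diff_distrib intro: summable_diff)

lemma entire_coeffs_cmult: "entire_coeffs a \<Longrightarrow> entire_coeffs (\<lambda>k. c * a k)"
  unfolding entire_coeffs_def by (auto simp: mult.assoc intro: summable_mult)

text \<open>Termwise differentiation keeps convergence everywhere, and \<open>y\<close> times the
  series of \<open>diffs a\<close> is the series of \<open>k * a k\<close>. The factor
  \<open>q + 2 * k\<close> is the one that differentiating \<open>x powr (q + 2 * k)\<close> brings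
  down.\<close>

lemma entire_coeffs_linear:
  assumes "entire_coeffs a"
  shows "entire_coeffs (\<lambda>k. (q + 2 * real k) * a k)"
proof -
  have "summable (\<lambda>k. diffs a k * y ^ k)" for y
    using termdiff_converges_all[of a y] assms by (simp add: entire_coeffs_def)
  then have "summable (\<lambda>k. y * (diffs a k * y ^ k))" for y
    by (rule summable_mult)
  moreover have "(\<lambda>k. y * (diffs a k * y ^ k)) = (\<lambda>k. real (Suc k) * a (Suc k) * y ^ Suc k)" for y
    by (simp add: diffs_def mult_ac)
  ultimately have "summable (\<lambda>k. real (Suc k) * a (Suc k) * y ^ Suc k)" for y
    by metis
  then have "entire_coeffs (\<lambda>k. real k * a k)"
    unfolding entire_coeffs_def
    by (intro allI) (subst summable_Suc_iff[symmetric], simp)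
  from entire_coeffs_add[OF entire_coeffs_cmult[OF assms, of q] entire_coeffs_cmult[OF this, of 2]]
  show ?thesis by (simp add: distrib_right mult.assoc)
qed

lemma entire_coeffs_dominated:
  assumes "entire_coeffs b" "\<And>k. \<bar>a k\<bar> \<le> C * \<bar>b k\<bar>"
  shows "entire_coeffs a"
  unfolding entire_coeffs_def
proof
  fix y
  \<comment> \<open>Convergence at the larger point \<open>|y| + 1\<close> gives absolute
    convergence at \<open>|y|\<close>.\<close>
  have "summable (\<lambda>k. \<bar>b k * \<bar>y\<bar> ^ k\<bar>)"
    using powser_insidea[of b "\<bar>y\<bar> + 1" "\<bar>y\<bar>"] assms(1) by (simp add: entire_coeffs_def)
  then have "summable (\<lambda>k. C * \<bar>b k * \<bar>y\<bar> ^ k\<bar>)"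
    by (rule summable_mult)
  then show "summable (\<lambda>k. a k * y ^ k)"
  proof (rule summable_comparison_test')
    fix k :: nat
    have "\<bar>a k\<bar> * \<bar>y\<bar> ^ k \<le> (C * \<bar>b k\<bar>) * \<bar>y\<bar> ^ k"
      by (intro mult_right_mono assms) simp
    then show "norm (a k * y ^ k) \<le> C * \<bar>b k * \<bar>y\<bar> ^ k\<bar>"
      by (simp add: abs_mult power_abs)
  qed
qed

lemma entire_coeffs_ratio:
  assumes "\<And>k. a (Suc k) = r k * a k" "r \<longlonglongrightarrow> 0"
  shows "entire_coeffs a"
  unfolding entire_coeffs_def
proof
  fix y :: real
  have "(\<lambda>k. \<bar>r k * y\<bar>) \<longlonglongrightarrow> \<bar>0 * y\<bar>"
    by (intro tendsto_intros assms)
  then have "\<forall>\<^sub>F k in sequentially. \<bar>r k * y\<bar> < 1 / 2"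
    by (rule order_tendstoD) simp
  then obtain N where N: "\<And>k. k \<ge> N \<Longrightarrow> \<bar>r k * y\<bar> < 1 / 2"
    by (auto simp: eventually_sequentially)
  show "summable (\<lambda>k. a k * y ^ k)"
  proof (rule summable_ratio_test[of "1/2" N])
    fix k assume "N \<le> k"
    have "norm (a (Suc k) * y ^ Suc k) = \<bar>r k * y\<bar> * norm (a k * y ^ k)"
      by (simp add: assms(1) abs_mult mult_ac)
    also have "\<dots> \<le> 1 / 2 * norm (a k * y ^ k)"
      using N[OF \<open>N \<le> k\<close>] by (intro mult_right_mono) auto
    finally show "norm (a (Suc k) * y ^ Suc k) \<le> 1 / 2 * norm (a k * y ^ k)" .
  qed simp
qed

lemma pser_add:
  "entire_coeffs a \<Longrightarrow> entire_coeffs b \<Longrightarrow> pser q (\<lambda>k. a k + b k) x = pser q a x + pser q b x"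
  unfolding pser_def
  by (simp add: distrib_right distrib_left suminf_add[symmetric] entire_coeffsD)

lemma pser_cmult: "entire_coeffs a \<Longrightarrow> pser q (\<lambda>k. c * a k) x = c * pser q a x"
  unfolding pser_def by (simp add: mult.assoc suminf_mult entire_coeffsD)

lemma pser_diff:
  "entire_coeffs a \<Longrightarrow> entire_coeffs b \<Longrightarrow> pser q (\<lambda>k. a k - b k) x = pser q a x - pser q b x"
  using pser_add[of a "\<lambda>k. (-1) * b k" q x] pser_cmult[of b q "-1" x] entire_coeffs_cmult[of b "-1"]
  by simp

lemma pser_pos:
  assumes "entire_coeffs a" "\<And>k. a k \<ge> 0" "a j > 0" "x > 0"
  shows "pser q a x > 0"
proof -
  have "0 < (\<Sum>k. a k * (x\<^sup>2) ^ k)"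
    by (rule suminf_pos2[OF entire_coeffsD[OF assms(1)], where i = j]) (use assms in auto)
  then show ?thesis
    using assms(4) by (simp add: pser_def)
qed

lemma pser_less:
  assumes "entire_coeffs a" "entire_coeffs b" "\<And>k. a k \<le> b k" "a j < b j" "x > 0"
  shows "pser q a x < pser q b x"
  using pser_pos[of "\<lambda>k. b k - a k" j x q] pser_diff[of b a q x] assms
  by (simp add: entire_coeffs_diff)

text \<open>The surplus factor \<open>x^2\<close> is absorbed as an index shift, so that series
  whose prefactors differ by two powers of \<open>x\<close> can be compared coefficient by
  coefficient.\<close>

lemma pser_shift:
  assumes "entire_coeffs a" "x > 0"
  shows "pser (q + 2) a x = pser q (\<lambda>k. case k of 0 \<Rightarrow> 0 | Suc j \<Rightarrow> a j) x"
    and "entire_coeffs (\<lambda>k. case k of 0 \<Rightarrow> 0 | Suc j \<Rightarrow> a j)"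
proof -
  let ?b = "\<lambda>k. case k of 0 \<Rightarrow> 0 | Suc j \<Rightarrow> a j"
  have *: "(\<lambda>k. ?b (Suc k) * y ^ Suc k) = (\<lambda>k. y * (a k * y ^ k))" for y
    by (simp add: mult_ac)
  have s: "summable (\<lambda>k. ?b (Suc k) * y ^ Suc k)" for y
    unfolding * by (intro summable_mult entire_coeffsD assms)
  then have t: "summable (\<lambda>k. ?b k * y ^ k)" for y
    by (subst summable_Suc_iff[symmetric])
  then show "entire_coeffs ?b" by (simp add: entire_coeffs_def)
  have "(\<Sum>k. ?b k * (x\<^sup>2) ^ k) = (\<Sum>k. ?b (Suc k) * (x\<^sup>2) ^ Suc k)"
    using suminf_split_head[OF t[of "x\<^sup>2"]] by simp
  also have "\<dots> = x\<^sup>2 * (\<Sum>k. a k * (x\<^sup>2) ^ k)"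
    unfolding * by (intro suminf_mult entire_coeffsD assms)
  finally show "pser (q + 2) a x = pser q ?b x"
    using assms(2) by (simp add: pser_def powr_add powr_numeral mult_ac)
qed

lemma isCont_power_series_even:
  assumes "entire_coeffs a"
  shows "isCont (\<lambda>x. \<Sum>k. a k * (x\<^sup>2) ^ k) x"
proof -
  have "isCont (\<lambda>y. \<Sum>k. a k * y ^ k) (x\<^sup>2)"
    by (rule isCont_powser[where K = "x\<^sup>2 + 1"]) (use assms in \<open>auto simp: entire_coeffs_def\<close>)
  then show ?thesis
    using isCont_o2[of x "\<lambda>x. x\<^sup>2" "\<lambda>y. \<Sum>k. a k * y ^ k"] by (simp add: continuous_intros)
qed

lemma continuous_on_pser:
  assumes "entire_coeffs a" "q > 0"
  shows "continuous_on {0..} (pser q a)"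
  unfolding pser_def using assms
  by (intro continuous_intros continuous_at_imp_continuous_on continuous_on_powr' ballI
        isCont_power_series_even) auto

lemma has_real_derivative_pser:
  assumes a: "entire_coeffs a" and x: "x > 0"
  shows "(pser q a has_real_derivative pser (q - 1) (\<lambda>k. (q + 2 * real k) * a k) x) (at x)"
proof -
  let ?S = "\<lambda>c. \<Sum>k. c k * (x\<^sup>2) ^ k"
  have sd: "summable (\<lambda>k. diffs a k * y ^ k)" for y
    using termdiff_converges_all[of a y] a by (simp add: entire_coeffs_def)
  have "((\<lambda>y. \<Sum>k. a k * y ^ k) has_real_derivative ?S (diffs a)) (at (x\<^sup>2))"
    by (rule termdiffs[where K = "x\<^sup>2 + 1"]) (use a sd in \<open>auto simp: entire_coeffs_def
          intro: termdiff_converges_all\<close>)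
  then have dS: "((\<lambda>x. \<Sum>k. a k * (x\<^sup>2) ^ k) has_real_derivative ?S (diffs a) * (2 * x)) (at x)"
    by (rule DERIV_chain2[where g = "\<lambda>x. x\<^sup>2"]) (auto intro!: derivative_eq_intros)
  \<comment> \<open>The chain rule produces \<open>2 * x\<close> times the series of
    \<open>diffs a\<close>. Absorbing \<open>x^2\<close> turns this into the series of
    \<open>k * a k\<close>, which goes with the prefactor \<open>x powr (q - 1)\<close>.\<close>
  have n: "entire_coeffs (\<lambda>k. real k * a k)"
    using entire_coeffs_cmult[OF entire_coeffs_linear[OF a, of 0], of "1/2"] by (simp add: mult_ac)
  have "?S (\<lambda>k. real k * a k) = (\<Sum>k. real (Suc k) * a (Suc k) * (x\<^sup>2) ^ Suc k)"
    using suminf_split_head[OF entire_coeffsD[OF n, of "x\<^sup>2"]] by simp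
  also have "\<dots> = (\<Sum>k. x\<^sup>2 * (diffs a k * (x\<^sup>2) ^ k))"
    by (simp add: diffs_def mult_ac)
  also have "\<dots> = x\<^sup>2 * ?S (diffs a)"
    by (rule suminf_mult[OF sd])
  finally have eq: "?S (\<lambda>k. real k * a k) = x\<^sup>2 * ?S (diffs a)" .
  have sp: "pser (q - 1) (\<lambda>k. (q + 2 * real k) * a k) x
      = q * pser (q - 1) a x + 2 * pser (q - 1) (\<lambda>k. real k * a k) x"
    using pser_add[of "\<lambda>k. q * a k" "\<lambda>k. 2 * (real k * a k)" "q - 1" x] a n
    by (simp add: pser_cmult entire_coeffs_cmult distrib_right mult.assoc)
  have xq: "x powr q = x powr (q - 1) * x"
    using x by (simp add: powr_diff)
  have dp: "((\<lambda>x. x powr q) has_real_derivative q * x powr (q - 1)) (at x)"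
    using x by (rule has_real_derivative_powr)
  show ?thesis
    unfolding pser_def[of q a, abs_def]
  proof (rule DERIV_cong[OF DERIV_mult[OF dp dS]])
    have "u * v * w + z * (2 * x) * (v * x) = u * (v * w) + 2 * (v * (x\<^sup>2 * z))" for u v w z :: real
      by (simp add: power2_eq_square algebra_simps)
    then show "q * x powr (q - 1) * ?S a + ?S (diffs a) * (2 * x) * x powr q
        = pser (q - 1) (\<lambda>k. (q + 2 * real k) * a k) x"
      unfolding sp unfolding pser_def eq xq .
  qed
qed

text \<open>For \<open>q < 1\<close> the integrand may be unbounded near \<open>0\<close>. The
  fundamental theorem is therefore used in the form that asks for differentiability in the interior
  only, together with continuity of the antiderivative up to the endpoints.\<close>

lemma has_integral_pser:
  assumes a: "entire_coeffs a" and q: "q > 0" and x: "x \<ge> 0"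
  shows "(pser (q - 1) (\<lambda>k. (q + 2 * real k) * a k) has_integral pser q a x) {0..x}"
proof -
  have "(pser (q - 1) (\<lambda>k. (q + 2 * real k) * a k) has_integral (pser q a x - pser q a 0)) {0..x}"
  proof (rule fundamental_theorem_of_calculus_interior[OF x])
    show "continuous_on {0..x} (pser q a)"
      using continuous_on_pser[OF a q] by (rule continuous_on_subset) auto
    show "(pser q a has_vector_derivative pser (q - 1) (\<lambda>k. (q + 2 * real k) * a k) y) (at y)"
      if "y \<in> {0<..<x}" for y
      using has_real_derivative_pser[OF a, of y q] that
      by (simp add: has_real_derivative_iff_has_vector_derivative)
  qed
  then show ?thesis by (simp add: pser_def)
qed

text \<open>A power series whose coefficients are eventually positive dominates, for large arguments,
  its finitely many bad terms by a single higher-order one.\<close>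

lemma eventually_power_series_pos:
  assumes d: "entire_coeffs d" and ev: "\<forall>\<^sub>F k in sequentially. d k > 0"
  shows "\<forall>\<^sub>F y in at_top. (\<Sum>k. d k * y ^ k) > 0"
proof -
  obtain N where N: "\<And>k. k \<ge> N \<Longrightarrow> d k > 0"
    using ev by (auto simp: eventually_sequentially)
  define M where "M = (\<Sum>k<N. \<bar>d k\<bar>)"
  show ?thesis
    \<comment> \<open>For \<open>y > 1\<close> the terms below \<open>N\<close> are, after
      multiplication by \<open>y\<close>, bounded by \<open>M * y ^ N\<close>; beyond
      \<open>M / d N\<close> the term \<open>d N * y ^ N\<close> outweighs them.\<close>
    using eventually_gt_at_top[of "max 1 (M / d N)"]
  proof eventually_elim
    case (elim y)
    then have y: "y > 1" "M / d N < y" by auto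
    have dN: "d N > 0" by (rule N) simp
    have "\<bar>\<Sum>k<N. d k * y ^ k\<bar> * y \<le> (\<Sum>k<N. \<bar>d k * y ^ k\<bar>) * y"
      using y by (intro mult_right_mono sum_abs) auto
    also have "\<dots> = (\<Sum>k<N. \<bar>d k\<bar> * y ^ Suc k)"
      using y by (simp add: sum_distrib_right sum_distrib_left abs_mult mult_ac)
    also have "\<dots> \<le> (\<Sum>k<N. \<bar>d k\<bar> * y ^ N)"
      using y by (intro sum_mono mult_left_mono power_increasing) auto
    also have "\<dots> = M * y ^ N"
      by (simp add: M_def sum_distrib_right)
    also have "\<dots> < d N * y * y ^ N"
      using y dN by (intro mult_strict_right_mono) (auto simp: field_simps)
    finally have "\<bar>\<Sum>k<N. d k * y ^ k\<bar> < d N * y ^ N"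
      using y by (simp add: mult_ac)
    moreover have "(\<Sum>k\<in>{0}. d (k + N) * y ^ (k + N)) \<le> (\<Sum>k. d (k + N) * y ^ (k + N))"
      using y entire_coeffsD[OF d, of y]
      by (intro sum_le_suminf) (auto simp: summable_iff_shift[of "\<lambda>k. d k * y ^ k"]
            intro!: mult_nonneg_nonneg less_imp_le[OF N])
    ultimately show ?case
      using suminf_split_initial_segment[OF entire_coeffsD[OF d, of y], of N] by simp
  qed
qed

text \<open>The tool for sharpness of constants: a limit of coefficient ratios orders almost all
  coefficients of two series, and this orders the series themselves for large arguments.\<close>

lemma eventually_pser_less:
  assumes "entire_coeffs a" "entire_coeffs b" "\<forall>\<^sub>F k in sequentially. a k < b k"
  shows "\<forall>\<^sub>F x in at_top. pser q a x < pser q b x"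
proof -
  have "\<forall>\<^sub>F y in at_top. (\<Sum>k. (b k - a k) * y ^ k) > 0"
    using assms by (intro eventually_power_series_pos entire_coeffs_diff) auto
  moreover have "filterlim (\<lambda>x::real. x\<^sup>2) at_top at_top"
    by real_asymp
  ultimately have "\<forall>\<^sub>F x in at_top. (\<Sum>k. (b k - a k) * (x\<^sup>2) ^ k) > 0"
    by (rule eventually_compose_filterlim)
  then show ?thesis
    using eventually_gt_at_top[of 0]
  proof eventually_elim
    case (elim x)
    then have "pser q (\<lambda>k. b k - a k) x > 0" by (simp add: pser_def)
    then show ?case by (simp add: pser_diff assms)
  qed
qed

section \<open>Coefficients of the modified Struve function\<close>

text \<open>The coefficient of \<open>x powr (\<mu> + 1) * (x^2) ^ k\<close> in
  \<open>struve_L \<mu> x\<close>, with the powers of \<open>2\<close> from the argument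
  \<open>x / 2\<close> included.\<close>

definition struve_coeff :: "real \<Rightarrow> nat \<Rightarrow> real" where
  "struve_coeff \<mu> k = rGamma (real k + 3 / 2) * rGamma (real k + \<mu> + 3 / 2) / 2 powr (\<mu> + 2 * real k + 1)"

lemma rGamma_pos_real: "(x::real) > 0 \<Longrightarrow> rGamma x > 0"
  using Gamma_real_pos[of x] by (simp add: rGamma_inverse_Gamma)

lemma struve_coeff_pos: "\<mu> > - 3 / 2 \<Longrightarrow> struve_coeff \<mu> k > 0"
  unfolding struve_coeff_def
  by (intro divide_pos_pos mult_pos_pos rGamma_pos_real) auto

lemma rGamma_shift: "(z::real) > 0 \<Longrightarrow> rGamma (z + 1) = rGamma z / z"
  using rGamma_plus1[of z] by (auto simp: field_simps)

lemma struve_coeff_Suc: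
  assumes "\<mu> > - 3 / 2"
  shows "struve_coeff \<mu> (Suc k) = 1 / ((2 * real k + 3) * (2 * real k + 2 * \<mu> + 3)) * struve_coeff \<mu> k"
proof -
  have 1: "rGamma (real (Suc k) + 3 / 2) = rGamma (real k + 3 / 2) / (real k + 3 / 2)"
    using rGamma_shift[of "real k + 3 / 2"] by (simp add: add_ac)
  have 2: "rGamma (real (Suc k) + \<mu> + 3 / 2) = rGamma (real k + \<mu> + 3 / 2) / (real k + \<mu> + 3 / 2)"
    using rGamma_shift[of "real k + \<mu> + 3 / 2"] assms by (simp add: add_ac)
  have 3: "2 powr (\<mu> + 2 * real (Suc k) + 1) = 2 powr (\<mu> + 2 * real k + 1) * (4::real)"
  proof -
    have "\<mu> + 2 * real (Suc k) + 1 = \<mu> + 2 * real k + 1 + 2" by simp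
    then show ?thesis by (simp only: powr_add[of _ _ 2]) simp
  qed
  have "(2 * real k + 3) * (2 * real k + 2 * \<mu> + 3) = (real k + 3 / 2) * (real k + \<mu> + 3 / 2) * 4"
    by (simp add: algebra_simps)
  then show ?thesis
    unfolding struve_coeff_def 1 2 3 by (simp add: mult_ac)
qed

text \<open>Raising the order moves one Gamma argument by \<open>1\<close>, so it divides by a
  factor linear in \<open>k\<close>, as termwise integration does. Comparing these two linear
  factors is the basis of the coefficientwise bounds.\<close>

lemma struve_coeff_order_Suc:
  assumes "\<mu> > - 3 / 2"
  shows "struve_coeff (\<mu> + 1) k = struve_coeff \<mu> k / (2 * real k + 2 * \<mu> + 3)"
proof -
  have 2: "rGamma (real k + (\<mu> + 1) + 3 / 2) = rGamma (real k + \<mu> + 3 / 2) / (real k + \<mu> + 3 / 2)"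
    using rGamma_shift[of "real k + \<mu> + 3 / 2"] assms by (simp add: add_ac)
  have 3: "2 powr ((\<mu> + 1) + 2 * real k + 1) = 2 powr (\<mu> + 2 * real k + 1) * (2::real)"
  proof -
    have "(\<mu> + 1) + 2 * real k + 1 = \<mu> + 2 * real k + 1 + 1" by simp
    then show ?thesis by (simp only: powr_add[of _ _ 1]) simp
  qed
  have "2 * real k + 2 * \<mu> + 3 = (real k + \<mu> + 3 / 2) * 2"
    by (simp add: algebra_simps)
  then show ?thesis
    unfolding struve_coeff_def 2 3 by (simp add: mult_ac)
qed

lemma entire_struve_coeff: "\<mu> > - 3 / 2 \<Longrightarrow> entire_coeffs (struve_coeff \<mu>)"
  by (rule entire_coeffs_ratio[where r = "\<lambda>k. 1 / ((2 * real k + 3) * (2 * real k + 2 * \<mu> + 3))"])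
    (rule struve_coeff_Suc, assumption, real_asymp)

lemma struve_L_pser:
  assumes "\<mu> > - 3 / 2" "x \<ge> 0"
  shows "x powr \<nu> * struve_L \<mu> x = pser (\<nu> + \<mu> + 1) (struve_coeff \<mu>) x"
\<comment> \<open>At \<open>x = 0\<close> both sides vanish because \<open>0 powr q = 0\<close>;
  this keeps the identity valid on closed intervals starting at \<open>0\<close>.\<close>
proof (cases "x = 0")
  case False
  with assms have x: "x > 0" by simp
  have "(x / 2) powr (\<mu> + 2 * real k + 1) * rGamma (real k + 3 / 2) * rGamma (real k + \<mu> + 3 / 2)
      = x powr (\<mu> + 1) * (struve_coeff \<mu> k * (x\<^sup>2) ^ k)" for k
  proof -
    have "\<mu> + 2 * real k + 1 = (\<mu> + 1) + real (2 * k)" by simp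
    then have "x powr (\<mu> + 2 * real k + 1) = x powr (\<mu> + 1) * (x\<^sup>2) ^ k"
      using x by (simp only: powr_add powr_realpow power_mult)
    then show ?thesis using x by (simp add: struve_coeff_def powr_divide mult_ac)
  qed
  then have "struve_L \<mu> x = x powr (\<mu> + 1) * (\<Sum>k. struve_coeff \<mu> k * (x\<^sup>2) ^ k)"
    unfolding struve_L_def using entire_coeffsD[OF entire_struve_coeff[OF assms(1)]]
    by (simp only: suminf_mult)
  then show ?thesis using x by (simp add: pser_def powr_add mult_ac)
qed (simp add: pser_def)

text \<open>For \<open>\<mu> \<ge> -1\<close> each step of the recurrence divides by at least
  \<open>(2 * k + 2) * (2 * k + 1)\<close>, which is the step between consecutive coefficients of
  \<open>cosh\<close>.\<close>

lemma struve_coeff_le: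
  assumes "\<mu> \<ge> -1"
  shows "struve_coeff \<mu> k \<le> struve_coeff \<mu> 0 / fact (2 * k)"
proof (induction k)
  case (Suc k)
  have "struve_coeff \<mu> (Suc k) = struve_coeff \<mu> k / ((2 * real k + 3) * (2 * real k + 2 * \<mu> + 3))"
    using assms by (simp add: struve_coeff_Suc)
  also have "\<dots> \<le> struve_coeff \<mu> k / ((2 * real k + 2) * (2 * real k + 1))"
    using assms struve_coeff_pos[of \<mu> k]
    by (intro divide_left_mono mult_mono mult_pos_pos) auto
  also have "\<dots> \<le> (struve_coeff \<mu> 0 / fact (2 * k)) / ((2 * real k + 2) * (2 * real k + 1))"
    by (intro divide_right_mono Suc.IH) auto
  also have "\<dots> = struve_coeff \<mu> 0 / fact (2 * Suc k)"
    by (simp add: algebra_simps)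
  finally show ?case .
qed simp

lemma pser_struve_coeff_le_exp:
  assumes "\<mu> \<ge> -1" "x > 0"
  shows "pser q (struve_coeff \<mu>) x \<le> struve_coeff \<mu> 0 * x powr q * exp x"
proof -
  \<comment> \<open>The series of \<open>cosh\<close> runs over all exponents with zeros at the odd
    ones; reindexing by \<open>2 * k\<close> drops these zeros.\<close>
  have "strict_mono (\<lambda>k::nat. 2 * k)"
    by (simp add: strict_mono_def)
  then have "(\<lambda>k. (\<lambda>n. if even n then x ^ n /\<^sub>R fact n else 0) (2 * k)) sums cosh x"
    by (subst sums_mono_reindex) (auto simp: cosh_converges)
  then have "(\<lambda>k. x ^ (2 * k) / fact (2 * k)) sums cosh x"
    by (simp add: divide_inverse_commute)
  then have c: "(\<lambda>k. struve_coeff \<mu> 0 * ((x\<^sup>2) ^ k / fact (2 * k))) sums (struve_coeff \<mu> 0 * cosh x)"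
    by (intro sums_mult) (simp add: power_mult)
  have e: "entire_coeffs (struve_coeff \<mu>)"
    using assms by (intro entire_struve_coeff) auto
  have "(\<Sum>k. struve_coeff \<mu> k * (x\<^sup>2) ^ k) \<le> struve_coeff \<mu> 0 * cosh x"
  proof (rule sums_le[OF _ summable_sums[OF entire_coeffsD[OF e]] c])
    show "struve_coeff \<mu> k * (x\<^sup>2) ^ k \<le> struve_coeff \<mu> 0 * ((x\<^sup>2) ^ k / fact (2 * k))" for k
      using mult_right_mono[OF struve_coeff_le[OF assms(1), of k], of "(x\<^sup>2) ^ k"] by simp
  qed
  also have "cosh x \<le> exp x"
    using assms by (simp add: cosh_field_def)
  finally have "(\<Sum>k. struve_coeff \<mu> k * (x\<^sup>2) ^ k) \<le> struve_coeff \<mu> 0 * exp x"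
    using struve_coeff_pos[of \<mu> 0] assms by (simp add: mult_left_mono)
  from mult_left_mono[OF this, of "x powr q"] show ?thesis
    by (simp add: pser_def mult_ac)
qed

text \<open>This is the classical rule that \<open>x powr \<mu> * struve_L \<mu> x\<close> has
  derivative \<open>x powr \<mu> * struve_L (\<mu> - 1) x\<close>: the factor from differentiation
  is the one that lowers the order.\<close>

lemma has_real_derivative_pser_struve:
  assumes "\<mu> > - 1 / 2" "x > 0"
  shows "(pser (2 * \<mu> + 1) (struve_coeff \<mu>) has_real_derivative pser (2 * \<mu>) (struve_coeff (\<mu> - 1)) x) (at x)"
proof -
  have "(2 * \<mu> + 1 + 2 * real k) * struve_coeff \<mu> k = struve_coeff (\<mu> - 1) k" for k
    using struve_coeff_order_Suc[of "\<mu> - 1" k] assms by (simp add: field_simps)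
  then show ?thesis
    using has_real_derivative_pser[of "struve_coeff \<mu>" x "2 * \<mu> + 1"] entire_struve_coeff[of \<mu>] assms
    by simp
qed

text \<open>With \<open>f x = x powr \<nu> * struve_L \<nu> x\<close>, the Struve equation gives
  \<open>f'' = f + (2 * \<nu> - 1) * f' / x + c * x powr (2 * \<nu> - 1)\<close> with \<open>c > 0\<close>; hence \<open>f'' > f\<close>,
  and \<open>exp x * (f' x - f x)\<close> increases from \<open>0\<close>.\<close>

lemma pser_struve_less_derivative:
  assumes nu: "\<nu> \<ge> 1 / 2" and x: "x > 0"
  shows "pser (2 * \<nu> + 1) (struve_coeff \<nu>) x < pser (2 * \<nu>) (struve_coeff (\<nu> - 1)) x"
proof -
  define f where "f = pser (2 * \<nu> + 1) (struve_coeff \<nu>)"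
  define f' where "f' = pser (2 * \<nu>) (struve_coeff (\<nu> - 1))"
  define f'' where "f'' = pser (2 * \<nu> - 1) (\<lambda>k. (2 * \<nu> + 2 * real k) * struve_coeff (\<nu> - 1) k)"
  have e: "entire_coeffs (struve_coeff \<nu>)" "entire_coeffs (struve_coeff (\<nu> - 1))"
    using nu by (auto intro: entire_struve_coeff)
  have df: "(f has_real_derivative f' y) (at y)" if "y > 0" for y
    unfolding f_def f'_def using has_real_derivative_pser_struve[of \<nu> y] nu that by simp
  have df': "(f' has_real_derivative f'' y) (at y)" if "y > 0" for y
    unfolding f'_def f''_def using has_real_derivative_pser[OF e(2) that, of "2 * \<nu>"] .
  have gt: "f y < f'' y" if y: "y > 0" for y
  proof -
    \<comment> \<open>The coefficients of \<open>f\<close> rewritten for the prefactor of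
      \<open>f''\<close>; the new zeroth coefficient is \<open>0\<close>, and there the comparison
      is strict.\<close>
    let ?s = "\<lambda>k. case k of 0 \<Rightarrow> 0 | Suc j \<Rightarrow> struve_coeff \<nu> j"
    have "f y = pser (2 * \<nu> - 1) ?s y"
      using pser_shift(1)[OF e(1) y, of "2 * \<nu> - 1"] by (simp add: f_def add.commute)
    also have "\<dots> < f'' y"
      unfolding f''_def
    proof (rule pser_less[where j = 0])
      show "entire_coeffs ?s" by (rule pser_shift(2)[OF e(1) y])
      show "entire_coeffs (\<lambda>k. (2 * \<nu> + 2 * real k) * struve_coeff (\<nu> - 1) k)"
        by (rule entire_coeffs_linear[OF e(2)])
      show "?s k \<le> (2 * \<nu> + 2 * real k) * struve_coeff (\<nu> - 1) k" for k
      proof (cases k)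
        case 0
        then show ?thesis using nu struve_coeff_pos[of "\<nu> - 1" 0] by simp
      next
        case (Suc j)
        have "struve_coeff (\<nu> - 1) (Suc j) = (2 * real j + 2 * \<nu> + 3) * struve_coeff \<nu> (Suc j)"
          using struve_coeff_order_Suc[of "\<nu> - 1" "Suc j"] nu by (simp add: field_simps)
        also have "\<dots> = struve_coeff \<nu> j / (2 * real j + 3)"
          using struve_coeff_Suc[of \<nu> j] nu add_nonneg_pos[of "2 * real j" "2 * \<nu> + 3"] by simp
        finally have "(2 * \<nu> + 2 * real k) * struve_coeff (\<nu> - 1) k
            = (2 * \<nu> + 2 * real j + 2) / (2 * real j + 3) * struve_coeff \<nu> j"
          by (simp add: Suc add_ac)
        \<comment> \<open>The quotient is at least \<open>1\<close> if and only if
          \<open>2 * \<nu> \<ge> 1\<close>.\<close>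
        moreover have "1 * struve_coeff \<nu> j \<le> (2 * \<nu> + 2 * real j + 2) / (2 * real j + 3) * struve_coeff \<nu> j"
          using nu struve_coeff_pos[of \<nu> j] by (intro mult_right_mono) auto
        ultimately show ?thesis by (simp add: Suc)
      qed
      show "?s 0 < (2 * \<nu> + 2 * real 0) * struve_coeff (\<nu> - 1) 0"
        using nu struve_coeff_pos[of "\<nu> - 1" 0] by simp
    qed (rule y)
    finally show ?thesis .
  qed
  define h where "h = (\<lambda>y. exp y * (f' y - f y))"
  have "h 0 < h x"
  proof (rule DERIV_pos_imp_increasing_open[OF x])
    fix y assume "0 < y" "y < x"
    have "(h has_real_derivative exp y * (f'' y - f y)) (at y)"
      unfolding h_def
      by (rule derivative_eq_intros df df' \<open>0 < y\<close> refl)+ (simp add: algebra_simps)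
    then show "\<exists>d. (h has_real_derivative d) (at y) \<and> d > 0"
      using gt[OF \<open>0 < y\<close>] by (intro exI conjI) auto
  next
    have "continuous_on {0..} f" "continuous_on {0..} f'"
      unfolding f_def f'_def using nu by (intro continuous_on_pser e; simp)+
    then have "continuous_on {0..} h"
      unfolding h_def by (intro continuous_intros)
    then show "continuous_on {0..x} h"
      by (rule continuous_on_subset) auto
  qed
  then show ?thesis
    by (simp add: h_def f_def f'_def pser_def zero_less_mult_iff)
qed

section \<open>Exponential growth and damped integrals\<close>

text \<open>The function \<open>exp (- \<kappa> * x) * G x\<close> is nondecreasing, so it stays
  above its positive value at \<open>X\<close>; a growth rate \<open>\<rho> < \<kappa>\<close> would
  force it to tend to \<open>0\<close> or below.\<close>

lemma exponential_growth_contradiction: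
  fixes G G' :: "real \<Rightarrow> real"
  assumes deriv: "\<And>x. x \<ge> X \<Longrightarrow> (G has_real_derivative G' x) (at x)"
    and ge: "\<And>x. x \<ge> X \<Longrightarrow> \<kappa> * G x \<le> G' x"
    and pos: "G X > 0"
    and le: "\<And>x. x \<ge> X \<Longrightarrow> G x \<le> K * x powr q * exp (\<rho> * x)"
    and lt: "\<rho> < \<kappa>"
  shows False
proof -
  define H where "H = (\<lambda>x. exp (- \<kappa> * x) * G x)"
  have "H X \<le> K * (x powr q * exp (- (\<kappa> - \<rho>) * x))" if "x \<ge> X" for x
  proof -
    have "H X \<le> H x"
    proof (rule DERIV_nonneg_imp_nondecreasing[OF that])
      fix y assume "X \<le> y" "y \<le> x"
      have "(H has_real_derivative exp (- \<kappa> * y) * (G' y - \<kappa> * G y)) (at y)"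
        unfolding H_def
        by (rule derivative_eq_intros deriv \<open>X \<le> y\<close> refl)+ (simp add: algebra_simps)
      then show "\<exists>d. (H has_real_derivative d) (at y) \<and> d \<ge> 0"
        using ge[OF \<open>X \<le> y\<close>] by (intro exI conjI) auto
    qed
    also have "\<dots> \<le> exp (- \<kappa> * x) * (K * x powr q * exp (\<rho> * x))"
      unfolding H_def by (intro mult_left_mono le that) auto
    also have "\<dots> = K * (x powr q * (exp (- \<kappa> * x) * exp (\<rho> * x)))"
      by simp
    also have "exp (- \<kappa> * x) * exp (\<rho> * x) = exp (- (\<kappa> - \<rho>) * x)"
      by (simp add: exp_add[symmetric] algebra_simps)
    finally show ?thesis .
  qed
  then have "\<forall>\<^sub>F x in at_top. H X \<le> K * (x powr q * exp (- (\<kappa> - \<rho>) * x))"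
    by (intro eventually_at_top_linorderI)
  moreover have "\<kappa> - \<rho> > 0" using lt by simp
  then have "((\<lambda>x::real. x powr q * exp (- (\<kappa> - \<rho>) * x)) \<longlongrightarrow> 0) at_top"
    by real_asymp
  then have "((\<lambda>x. K * (x powr q * exp (- (\<kappa> - \<rho>) * x))) \<longlongrightarrow> K * 0) at_top"
    by (intro tendsto_intros)
  ultimately have "H X \<le> K * 0"
    by (intro tendsto_lowerbound[of _ "K * 0" at_top]) auto
  then show False using pos by (simp add: H_def mult_le_0_iff)
qed

lemma damped_integral_has_derivative:
  fixes g' :: "real \<Rightarrow> real"
  assumes "continuous_on {0..} g'" "x > 0"
  shows "((\<lambda>x. integral {0..x} (\<lambda>t. exp (- \<gamma> * t) * g' t)) has_real_derivative exp (- \<gamma> * x) * g' x) (at x)"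
proof -
  \<comment> \<open>The endpoint \<open>x + 1\<close> makes \<open>x\<close> an interior point, so
    the derivative is two-sided.\<close>
  have "continuous_on {0..x + 1} (\<lambda>t. exp (- \<gamma> * t) * g' t)"
    by (intro continuous_intros continuous_on_subset[OF assms(1)]) auto
  from integral_has_real_derivative[OF this, of x] show ?thesis
    using assms(2) by (simp add: at_within_Icc_at)
qed

text \<open>Meant for two pairs: an integral with its integrand, and
  \<open>x powr \<mu> * struve_L \<mu> x\<close> with its derivative. At \<open>\<gamma> = 0\<close>
  the difference of the two sides is identically \<open>0\<close>, whence the strict sign of
  \<open>\<gamma>\<close>.\<close>

lemma damped_integral_upper:
  fixes g g' :: "real \<Rightarrow> real"
  assumes cont: "continuous_on {0..} g" "continuous_on {0..} g'"
    and deriv: "\<And>x. x > 0 \<Longrightarrow> (g has_real_derivative g' x) (at x)"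
    and g0: "g 0 = 0" and less: "\<And>x. x > 0 \<Longrightarrow> g x < g' x"
    and \<gamma>: "\<gamma> > 0" and x: "x > 0"
  shows "(1 - \<gamma>) * integral {0..x} (\<lambda>t. exp (- \<gamma> * t) * g' t) < exp (- \<gamma> * x) * g x"
proof -
  define I where "I = (\<lambda>x. integral {0..x} (\<lambda>t. exp (- \<gamma> * t) * g' t))"
  define D where "D = (\<lambda>x. exp (- \<gamma> * x) * g x - (1 - \<gamma>) * I x)"
  have dI: "(I has_real_derivative exp (- \<gamma> * y) * g' y) (at y)" if "y > 0" for y
    unfolding I_def by (rule damped_integral_has_derivative[OF cont(2) that])
  have "D 0 < D x"
  proof (rule DERIV_pos_imp_increasing_open[OF x])
    fix y assume "0 < y" "y < x"
    have "(D has_real_derivative \<gamma> * exp (- \<gamma> * y) * (g' y - g y)) (at y)"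
      unfolding D_def
      by (rule derivative_eq_intros deriv dI \<open>0 < y\<close> refl)+ (simp add: algebra_simps)
    moreover have "\<gamma> * exp (- \<gamma> * y) * (g' y - g y) > 0"
      using less[OF \<open>0 < y\<close>] \<gamma> by simp
    ultimately show "\<exists>d. (D has_real_derivative d) (at y) \<and> d > 0"
      by blast
  next
    have "continuous_on {0..x} I"
      unfolding I_def
      by (intro indefinite_integral_continuous_1 integrable_continuous_real continuous_intros
            continuous_on_subset[OF cont(2)]) auto
    then show "continuous_on {0..x} D"
      unfolding D_def by (intro continuous_intros continuous_on_subset[OF cont(1)]) auto
  qed
  then show ?thesis by (simp add: D_def I_def g0)
qed

text \<open>If the constant \<open>c\<close> sufficed beyond \<open>X\<close>, then
  \<open>g < g'\<close> would make the integral grow at rate \<open>(1 - \<gamma>) / c\<close>,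
  while the bound on \<open>g\<close> allows only the rate \<open>1 - \<gamma>\<close>. The witness
  lies beyond an arbitrary \<open>X\<close> so that it can be combined with estimates valid for
  large arguments only.\<close>

lemma damped_integral_upper_best:
  fixes g g' :: "real \<Rightarrow> real"
  assumes cont: "continuous_on {0..} g'"
    and pos: "\<And>x. x > 0 \<Longrightarrow> g x > 0" and less: "\<And>x. x > 0 \<Longrightarrow> g x < g' x"
    and growth: "\<And>x. x > 0 \<Longrightarrow> g x \<le> K * x powr q * exp x"
    and \<gamma>: "\<gamma> < 1" and c: "0 < c" "c < 1"
  shows "\<exists>x>X. c * (exp (- \<gamma> * x) / (1 - \<gamma>) * g x) < integral {0..x} (\<lambda>t. exp (- \<gamma> * t) * g' t)"
proof (rule ccontr)
  define I where "I = (\<lambda>x. integral {0..x} (\<lambda>t. exp (- \<gamma> * t) * g' t))"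
  \<comment> \<open>From \<open>Y\<close> on, arguments are positive and exceed \<open>X\<close>
    strictly, so the negated claim applies to them.\<close>
  define Y where "Y = max 1 (X + 1)"
  assume "\<not> ?thesis"
  then have I: "I x \<le> c * (exp (- \<gamma> * x) / (1 - \<gamma>) * g x)" if "x \<ge> Y" for x
    using that by (force simp: I_def Y_def not_less)
  have Y: "x > 0" if "x \<ge> Y" for x
    using that by (simp add: Y_def)
  have I_pos: "I Y > 0"
  proof -
    have "continuous_on {0..Y} I"
      unfolding I_def
      by (intro indefinite_integral_continuous_1 integrable_continuous_real continuous_intros
            continuous_on_subset[OF cont]) auto
    then have "I 0 < I Y"
    proof (rule DERIV_pos_imp_increasing_open[OF Y[OF order_refl], rotated])
      fix y assume "0 < y" "y < Y"
      have "(I has_real_derivative exp (- \<gamma> * y) * g' y) (at y)"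
        unfolding I_def by (rule damped_integral_has_derivative[OF cont \<open>0 < y\<close>])
      moreover have "exp (- \<gamma> * y) * g' y > 0"
        using less[OF \<open>0 < y\<close>] pos[OF \<open>0 < y\<close>] by simp
      ultimately show "\<exists>d. (I has_real_derivative d) (at y) \<and> d > 0"
        by blast
    qed
    then show ?thesis by (simp add: I_def)
  qed
  show False
  proof (rule exponential_growth_contradiction[where G = I and \<kappa> = "(1 - \<gamma>) / c"
        and G' = "\<lambda>x. exp (- \<gamma> * x) * g' x" and X = Y
        and K = "c / (1 - \<gamma>) * K" and q = q and \<rho> = "1 - \<gamma>"])
    fix x assume x: "x \<ge> Y"
    show "(I has_real_derivative exp (- \<gamma> * x) * g' x) (at x)"
      unfolding I_def by (rule damped_integral_has_derivative[OF cont Y[OF x]])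
    have "(1 - \<gamma>) / c * I x \<le> (1 - \<gamma>) / c * (c * (exp (- \<gamma> * x) / (1 - \<gamma>) * g x))"
      using c \<gamma> by (intro mult_left_mono I x) auto
    also have "\<dots> = exp (- \<gamma> * x) * g x" using c \<gamma> by simp
    also have "\<dots> \<le> exp (- \<gamma> * x) * g' x"
      using less[OF Y[OF x]] by simp
    finally show "(1 - \<gamma>) / c * I x \<le> exp (- \<gamma> * x) * g' x" .
    have "I x \<le> c * (exp (- \<gamma> * x) / (1 - \<gamma>) * (K * x powr q * exp x))"
      using c \<gamma> by (intro order_trans[OF I[OF x]] mult_left_mono growth Y[OF x]) auto
    also have "\<dots> = c / (1 - \<gamma>) * K * x powr q * (exp (- \<gamma> * x) * exp x)"
      by (simp add: mult_ac)
    also have "exp (- \<gamma> * x) * exp x = exp ((1 - \<gamma>) * x)"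
      by (simp add: exp_add[symmetric] algebra_simps)
    finally show "I x \<le> c / (1 - \<gamma>) * K * x powr q * exp ((1 - \<gamma>) * x)" .
  next
    show "1 - \<gamma> < (1 - \<gamma>) / c"
      using c \<gamma> mult_strict_left_mono[of c 1 "1 - \<gamma>"] by (simp add: less_divide_eq)
  qed (rule I_pos)
qed

section \<open>Exponential weight against nonnegative integrands\<close>

lemma exp_weight_integrable:
  fixes \<phi> :: "real \<Rightarrow> real"
  assumes "\<phi> integrable_on {0..x}" "\<And>t. t \<ge> 0 \<Longrightarrow> \<phi> t \<ge> 0"
  shows "(\<lambda>t. exp (- \<gamma> * t) * \<phi> t) integrable_on {0..x}"
proof -
  have "bounded ((\<lambda>t. exp (- \<gamma> * t)) ` {0..x})"
    by (intro compact_imp_bounded compact_continuous_image continuous_intros) simp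
  moreover have "(\<lambda>t. exp (- \<gamma> * t)) \<in> borel_measurable (lebesgue_on {0..x})"
    by (intro continuous_imp_measurable_on_sets_lebesgue continuous_intros) simp
  moreover have "\<phi> absolutely_integrable_on {0..x}"
    using assms by (intro nonnegative_absolutely_integrable_1) auto
  ultimately have "(\<lambda>t. exp (- \<gamma> * t) * \<phi> t) absolutely_integrable_on {0..x}"
    by (intro absolutely_integrable_bounded_measurable_product_real) auto
  then show ?thesis by (rule set_lebesgue_integral_eq_integral(1))
qed

text \<open>On \<open>{0..x}\<close> the weight lies between \<open>exp (- \<gamma> * x)\<close> and
  \<open>1\<close>.\<close>

lemma exp_weight_integral_bounds:
  fixes \<phi> :: "real \<Rightarrow> real"
  assumes int: "\<And>y. \<phi> integrable_on {0..y}" and nonneg: "\<And>t. t \<ge> 0 \<Longrightarrow> \<phi> t \<ge> 0"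
    and pos: "\<And>y. y > 0 \<Longrightarrow> integral {0..y} \<phi> > 0" and \<gamma>: "\<gamma> \<ge> 0" and x: "x > 0"
  shows "integral {0..x} (\<lambda>t. exp (- \<gamma> * t) * \<phi> t) \<le> integral {0..x} \<phi>"
    and "exp (- \<gamma> * x) * integral {0..x} \<phi> \<le> integral {0..x} (\<lambda>t. exp (- \<gamma> * t) * \<phi> t)"
    and "\<gamma> > 0 \<Longrightarrow> exp (- \<gamma> * x) * integral {0..x} \<phi> < integral {0..x} (\<lambda>t. exp (- \<gamma> * t) * \<phi> t)"
proof -
  let ?w = "\<lambda>t. exp (- \<gamma> * t) * \<phi> t"
  have intw: "?w integrable_on {a..b}" if "0 \<le> a" for a b
  proof (rule integrable_subinterval_real)
    show "?w integrable_on {0..b}" by (rule exp_weight_integrable[OF int nonneg])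
  qed (use that in auto)
  have intp: "\<phi> integrable_on {a..b}" if "0 \<le> a" for a b
    by (rule integrable_subinterval_real[OF int[of b]]) (use that in auto)
  show "integral {0..x} ?w \<le> integral {0..x} \<phi>"
  proof (rule integral_le[OF intw int])
    fix t assume "t \<in> {0..x}"
    then show "?w t \<le> \<phi> t"
      using nonneg[of t] mult_right_mono[of "exp (- \<gamma> * t)" 1 "\<phi> t"] \<gamma> by simp
  qed simp
  have low: "exp (- \<gamma> * b) * integral {a..b} \<phi> \<le> integral {a..b} ?w" if "0 \<le> a" for a b
  proof -
    have "integral {a..b} (\<lambda>t. exp (- \<gamma> * b) * \<phi> t) \<le> integral {a..b} ?w"
    proof (rule integral_le)
      fix t assume t: "t \<in> {a..b}"
      then have "exp (- \<gamma> * b) \<le> exp (- \<gamma> * t)"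
        using \<gamma> by (simp add: mult_left_mono)
      then show "exp (- \<gamma> * b) * \<phi> t \<le> ?w t"
        using t that by (intro mult_right_mono nonneg) auto
    qed (use integrable_on_cmult_left[OF intp[OF that, of b], of "exp (- \<gamma> * b)"] intw[OF that, of b]
          in simp_all)
    then show ?thesis by simp
  qed
  show "exp (- \<gamma> * x) * integral {0..x} \<phi> \<le> integral {0..x} ?w"
    by (rule low) simp
  assume "\<gamma> > 0"
  \<comment> \<open>Strictness comes from the left half: there the weight is at least
    \<open>exp (- \<gamma> * x / 2)\<close>, which is larger than
    \<open>exp (- \<gamma> * x)\<close>, and the integral of \<open>\<phi>\<close> is
    positive.\<close>
  have "exp (- \<gamma> * x) * integral {0..x} \<phi>
      = exp (- \<gamma> * x) * integral {0..x / 2} \<phi> + exp (- \<gamma> * x) * integral {x / 2..x} \<phi>"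
    using x Henstock_Kurzweil_Integration.integral_combine[of 0 "x / 2" x \<phi>] intp[of 0 x]
    by (simp add: distrib_left[symmetric])
  also have "\<dots> < exp (- \<gamma> * (x / 2)) * integral {0..x / 2} \<phi> + exp (- \<gamma> * x) * integral {x / 2..x} \<phi>"
    using \<open>\<gamma> > 0\<close> x pos[of "x / 2"] by (intro add_strict_right_mono mult_strict_right_mono) auto
  also have "\<dots> \<le> integral {0..x / 2} ?w + integral {x / 2..x} ?w"
    using x by (intro add_mono low) auto
  also have "\<dots> = integral {0..x} ?w"
    using x Henstock_Kurzweil_Integration.integral_combine[of 0 "x / 2" x ?w] intw[of 0 x] by simp
  finally show "exp (- \<gamma> * x) * integral {0..x} \<phi> < integral {0..x} ?w" .
qed

section \<open>Struve integrals as power series\<close>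

text \<open>Termwise integration. The condition \<open>\<nu> + \<mu> + 2 > 0\<close> expresses
  integrability at \<open>0\<close>, where the integrand behaves like
  \<open>t powr (\<nu> + \<mu> + 1)\<close>.\<close>

lemma struve_has_integral:
  assumes "\<mu> > - 3 / 2" "\<nu> + \<mu> + 2 > 0" "x \<ge> 0"
  shows "((\<lambda>t. t powr \<nu> * struve_L \<mu> t) has_integral
      pser (\<nu> + \<mu> + 2) (\<lambda>k. struve_coeff \<mu> k / (\<nu> + \<mu> + 2 + 2 * real k)) x) {0..x}"
    and "entire_coeffs (\<lambda>k. struve_coeff \<mu> k / (\<nu> + \<mu> + 2 + 2 * real k))"
proof -
  let ?q = "\<nu> + \<mu> + 2"
  let ?a = "\<lambda>k. struve_coeff \<mu> k / (?q + 2 * real k)"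
  have q: "?q + 2 * real k > 0" for k using assms(2) by simp
  show e: "entire_coeffs ?a"
  proof (rule entire_coeffs_dominated[OF entire_struve_coeff[OF assms(1)], of _ "1 / ?q"])
    show "\<bar>?a k\<bar> \<le> 1 / ?q * \<bar>struve_coeff \<mu> k\<bar>" for k
      using assms(2) q[of k] by (simp add: abs_divide divide_left_mono)
  qed
  have "(\<lambda>k. (?q + 2 * real k) * ?a k) = struve_coeff \<mu>"
    using q by (auto simp: less_imp_neq[THEN not_sym])
  then have "(pser (\<nu> + \<mu> + 1) (struve_coeff \<mu>) has_integral pser ?q ?a x) {0..x}"
    using has_integral_pser[OF e assms(2,3)] by (simp add: algebra_simps)
  then show "((\<lambda>t. t powr \<nu> * struve_L \<mu> t) has_integral pser ?q ?a x) {0..x}"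
    by (rule has_integral_eq[rotated]) (use assms in \<open>auto simp: struve_L_pser\<close>)
qed

lemma struve_damped_bounds:
  assumes "\<mu> > - 3 / 2" "\<nu> + \<mu> + 2 > 0" "\<gamma> \<ge> 0" "x > 0"
  defines "J \<equiv> integral {0..x} (\<lambda>t. t powr \<nu> * struve_L \<mu> t)"
    and "I \<equiv> integral {0..x} (\<lambda>t. exp (- \<gamma> * t) * t powr \<nu> * struve_L \<mu> t)"
  shows "0 < J" "I \<le> J" "exp (- \<gamma> * x) * J \<le> I" "\<gamma> > 0 \<Longrightarrow> exp (- \<gamma> * x) * J < I"
proof -
  let ?\<phi> = "\<lambda>t. t powr \<nu> * struve_L \<mu> t"
  have \<phi>: "?\<phi> integrable_on {0..y}" for y
  proof (cases "y \<ge> 0")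
    case True
    then show ?thesis using struve_has_integral(1)[OF assms(1,2)] by blast
  qed auto
  have nonneg: "?\<phi> t \<ge> 0" if "t \<ge> 0" for t
    using that assms(1) pser_pos[OF entire_struve_coeff[OF assms(1)], of 0 t] struve_coeff_pos[OF assms(1)]
    by (cases "t = 0") (auto simp: struve_L_pser less_imp_le)
  have pos: "integral {0..y} ?\<phi> > 0" if "y > 0" for y
  proof -
    have "pser (\<nu> + \<mu> + 2) (\<lambda>k. struve_coeff \<mu> k / (\<nu> + \<mu> + 2 + 2 * real k)) y > 0"
      using that assms(2) struve_coeff_pos[OF assms(1)]
      by (intro pser_pos[where j = 0] struve_has_integral(2)[OF assms(1,2), of y]) (auto simp: less_imp_le)
    then show ?thesis
      using integral_unique[OF struve_has_integral(1)[OF assms(1,2), of y]] that by simp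
  qed
  have I: "I = integral {0..x} (\<lambda>t. exp (- \<gamma> * t) * ?\<phi> t)"
    unfolding I_def by (simp add: mult.assoc)
  show "0 < J"
    unfolding J_def by (rule pos[OF assms(4)])
  show "I \<le> J"
    unfolding J_def I by (rule exp_weight_integral_bounds(1)[OF \<phi> nonneg pos assms(3,4)])
  show "exp (- \<gamma> * x) * J \<le> I"
    unfolding J_def I by (rule exp_weight_integral_bounds(2)[OF \<phi> nonneg pos assms(3,4)])
  show "exp (- \<gamma> * x) * J < I" if "\<gamma> > 0"
    unfolding J_def I by (rule exp_weight_integral_bounds(3)[OF \<phi> nonneg pos assms(3,4) that])
qed

section \<open>Coefficientwise bounds for the undamped integral\<close>

text \<open>Integrating divides the coefficient at \<open>k\<close> by \<open>q + 2 * k\<close>,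
  raising the order divides it by \<open>q + n + 1 + 2 * k\<close>. The second divisor is larger
  since \<open>n > -1\<close>, and the ratio of the two tends to \<open>1\<close>.\<close>

lemma struve_integral_lower:
  assumes "n > -1" "\<nu> > - (n + 2) / 2" "x > 0"
  shows "x powr \<nu> * struve_L (\<nu> + n + 1) x < integral {0..x} (\<lambda>t. t powr \<nu> * struve_L (\<nu> + n) t)"
    and "c > 1 \<Longrightarrow> \<forall>\<^sub>F x in at_top. integral {0..x} (\<lambda>t. t powr \<nu> * struve_L (\<nu> + n) t)
        < c * (x powr \<nu> * struve_L (\<nu> + n + 1) x)"
proof -
  define q where "q = 2 * \<nu> + n + 2"
  let ?a = "\<lambda>k. struve_coeff (\<nu> + n) k / (q + 2 * real k)"
  let ?b = "struve_coeff (\<nu> + n + 1)"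
  have q: "q > 0" using assms by (simp add: q_def field_simps)
  have mu: "\<nu> + n > - 3 / 2" using assms by (simp add: field_simps)
  have J: "integral {0..x} (\<lambda>t. t powr \<nu> * struve_L (\<nu> + n) t) = pser q ?a x" if "x > 0" for x
    using integral_unique[OF struve_has_integral(1)[OF mu, of \<nu> x]] q that
    by (simp add: q_def algebra_simps)
  have B: "x powr \<nu> * struve_L (\<nu> + n + 1) x = pser q ?b x" if "x > 0" for x
    using struve_L_pser[of "\<nu> + n + 1" x \<nu>] mu that by (simp add: q_def algebra_simps)
  have a: "entire_coeffs ?a"
    using struve_has_integral(2)[OF mu, of \<nu> x] q assms by (simp add: q_def algebra_simps)
  have b: "entire_coeffs ?b"
    using mu by (intro entire_struve_coeff) simp
  have s: "?b k = struve_coeff (\<nu> + n) k / (q + n + 1 + 2 * real k)" for k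
    using struve_coeff_order_Suc[OF mu, of k] by (simp add: q_def algebra_simps)
  have less: "?b k < ?a k" for k
    unfolding s using assms q struve_coeff_pos[OF mu, of k] by (intro divide_strict_left_mono) auto
  show "x powr \<nu> * struve_L (\<nu> + n + 1) x < integral {0..x} (\<lambda>t. t powr \<nu> * struve_L (\<nu> + n) t)"
    unfolding J[OF assms(3)] B[OF assms(3)]
    by (rule pser_less[OF b a]) (use less assms in \<open>auto intro: less_imp_le\<close>)
  assume c: "c > 1"
  have "(\<lambda>k. (q + n + 1 + 2 * real k) / (q + 2 * real k)) \<longlonglongrightarrow> 1"
    by real_asymp
  then have "\<forall>\<^sub>F k in sequentially. (q + n + 1 + 2 * real k) / (q + 2 * real k) < c"
    using c by (rule order_tendstoD)
  then have "\<forall>\<^sub>F k in sequentially. ?a k < c * ?b k"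
  proof eventually_elim
    case (elim k)
    have p: "q + 2 * real k > 0" "q + n + 1 + 2 * real k > 0"
      using q assms by (auto intro: add_pos_nonneg)
    have "?a k = (q + n + 1 + 2 * real k) / (q + 2 * real k) * ?b k"
      unfolding s using p by simp
    also have "\<dots> < c * ?b k"
      using elim by (rule mult_strict_right_mono) (use mu in \<open>auto intro: struve_coeff_pos\<close>)
    finally show ?case .
  qed
  then have "\<forall>\<^sub>F x in at_top. pser q ?a x < pser q (\<lambda>k. c * ?b k) x"
    by (intro eventually_pser_less a entire_coeffs_cmult b)
  then show "\<forall>\<^sub>F x in at_top. integral {0..x} (\<lambda>t. t powr \<nu> * struve_L (\<nu> + n) t)
        < c * (x powr \<nu> * struve_L (\<nu> + n + 1) x)"
    using eventually_gt_at_top[of 0]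
    by eventually_elim (simp add: J B pser_cmult[OF b])
qed

text \<open>Brings the elementary power of \<open>x\<close> in bound (3) into the format of the
  Struve terms, so that the whole bound becomes one series.\<close>

lemma pser_single:
  "pser q (\<lambda>k. case k of 0 \<Rightarrow> K | Suc j \<Rightarrow> 0) x = K * x powr q"
  "entire_coeffs (\<lambda>k. case k of 0 \<Rightarrow> K | Suc j \<Rightarrow> 0)"
proof -
  let ?s = "\<lambda>k. case k of 0 \<Rightarrow> K | Suc j \<Rightarrow> 0"
  have z: "?s k * y ^ k = 0" if "k \<notin> {0}" for k and y :: real
    using that by (cases k) auto
  show "entire_coeffs ?s"
    unfolding entire_coeffs_def by (intro allI summable_finite[of "{0}"] z) auto
  show "pser q ?s x = K * x powr q"
    unfolding pser_def by (subst suminf_finite[of "{0}"]) (use z in auto)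
qed

text \<open>The comparison of coefficients that drives bound (3): here \<open>s = 2 * k + A + n + 3\<close>,
  with \<open>A = 2 * \<nu> + n\<close> and \<open>k\<close> the summation index.\<close>

lemma upper_coeff_inequality:
  fixes A n s :: real
  assumes "A > -1" "n > -1" "s \<ge> A + n + 5"
  shows "1 / (s - n - 1) < ((A + 1) * (s + 2) + (n + 1) * (A + n + 4)) / ((A + 1) * s * (s + 2))"
proof -
  have pos: "s - n - 1 > 0" "s > 0" "(A + 1) * s * (s + 2) > 0"
    using assms by auto
  \<comment> \<open>The difference claimed next is
    \<open>(n + 3) * s - (n + 1) * (A + n + 4) - 2 * (A + 1)\<close>. It increases with
    \<open>s\<close> and equals \<open>3 * n + 9\<close> at \<open>s = A + n + 5\<close>, the value
    for \<open>k = 1\<close>.\<close>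
  have "(n + 3) * s \<ge> (n + 3) * (A + n + 5)"
    using assms by (intro mult_left_mono) auto
  then have "(s - n - 1) * (A + n + 4) - (A + 1) * (s + 2) > 0"
    using assms by (simp add: algebra_simps)
  then have "(n + 1) * ((s - n - 1) * (A + n + 4) - (A + 1) * (s + 2)) > 0"
    using assms by simp
  also have "(n + 1) * ((s - n - 1) * (A + n + 4) - (A + 1) * (s + 2))
      = (s - n - 1) * ((A + 1) * (s + 2) + (n + 1) * (A + n + 4)) - (A + 1) * s * (s + 2)"
    by (simp add: algebra_simps)
  finally show ?thesis
    using pos by (simp add: divide_less_eq less_divide_eq mult_ac)
qed

text \<open>The bound is a single series with coefficients \<open>d\<close>. These agree with those
  of the integral at \<open>k = 0\<close> and exceed them by a factor \<open>r k > 1\<close> at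
  \<open>k > 0\<close>; since \<open>r\<close> tends to \<open>1\<close>, the constant is
  sharp.\<close>

lemma struve_integral_upper:
  fixes \<nu> n :: real
  assumes "n > -1" "\<nu> > - (n + 1) / 2" "x > 0"
  defines "J \<equiv> \<lambda>x. integral {0..x} (\<lambda>t. t powr \<nu> * struve_L (\<nu> + n) t)"
    and "B \<equiv> \<lambda>x. x powr \<nu> / (2 * \<nu> + n + 1) *
                  (2 * (\<nu> + n + 1) * struve_L (\<nu> + n + 1) x
                   - (n + 1) * struve_L (\<nu> + n + 3) x
                   - (n + 1) * x powr (\<nu> + n + 2) /
                     (sqrt pi * 2 powr (\<nu> + n + 1) * (2 * \<nu> + n + 2) * Gamma (\<nu> + n + 5 / 2)))"
  shows "J x < B x" and "0 < c \<Longrightarrow> c < 1 \<Longrightarrow> \<forall>\<^sub>F x in at_top. c * B x < J x"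
proof -
  define A where "A = 2 * \<nu> + n"
  define m where "m = \<nu> + n"
  have A: "A > -1" using assms(2) by (simp add: A_def field_simps)
  have m: "m > -1" using assms(1,2) by (simp add: m_def field_simps)
  then have m': "m > - 3 / 2" by simp
  have m2: "2 * m = A + n" by (simp add: A_def m_def)
  let ?a = "\<lambda>k. struve_coeff m k / (A + 2 + 2 * real k)"
  \<comment> \<open>Multiplied by \<open>x powr \<nu>\<close>, the elementary term is
    \<open>(n + 1) * K * x powr (A + 2)\<close>, so it affects only the zeroth coefficient.\<close>
  define K where "K = 1 / (sqrt pi * 2 powr (m + 1) * (A + 2) * Gamma (m + 5 / 2))"
  let ?u = "struve_coeff (m + 1)"
  let ?v = "\<lambda>k. case k of 0 \<Rightarrow> 0 | Suc j \<Rightarrow> struve_coeff (m + 3) j"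
  let ?w = "\<lambda>k. case k of 0 \<Rightarrow> K | Suc j \<Rightarrow> 0"
  define d where "d = (\<lambda>k. 1 / (A + 1) * (2 * (m + 1) * ?u k - (n + 1) * ?v k - (n + 1) * ?w k))"
  have e: "entire_coeffs ?u" "entire_coeffs (struve_coeff (m + 3))"
    using m by (auto intro: entire_struve_coeff)
  have v: "entire_coeffs ?v"
    by (rule pser_shift(2)[OF e(2) assms(3)])
  have w: "entire_coeffs ?w" by (rule pser_single(2))
  note ent = entire_coeffs_diff entire_coeffs_cmult e(1) v w
  have d: "entire_coeffs d"
    unfolding d_def by (intro ent)
  have a: "entire_coeffs ?a"
    using struve_has_integral(2)[OF m', of \<nu> x] A assms(3) by (simp add: A_def m_def algebra_simps)
  have J: "J x = pser (A + 2) ?a x" if "x > 0" for x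
    using integral_unique[OF struve_has_integral(1)[OF m', of \<nu> x]] A that
    by (simp add: J_def A_def m_def algebra_simps)
  have B: "B x = pser (A + 2) d x" if "x > 0" for x
  proof -
    have 1: "x powr \<nu> * struve_L (m + 1) x = pser (A + 2) ?u x"
      using struve_L_pser[of "m + 1" x \<nu>] m that by (simp add: A_def m_def algebra_simps)
    have "x powr \<nu> * struve_L (m + 3) x = pser (A + 2 + 2) (struve_coeff (m + 3)) x"
      using struve_L_pser[of "m + 3" x \<nu>] m that by (simp add: A_def m_def algebra_simps)
    then have 2: "x powr \<nu> * struve_L (m + 3) x = pser (A + 2) ?v x"
      using pser_shift(1)[OF e(2) that, of "A + 2"] by simp
    have 3: "x powr \<nu> * (K * x powr (m + 2)) = pser (A + 2) ?w x"
      by (simp add: pser_single(1) A_def m_def powr_add[symmetric] algebra_simps)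
    have "pser (A + 2) d x = 1 / (A + 1) * (2 * (m + 1) * (x powr \<nu> * struve_L (m + 1) x)
        - (n + 1) * (x powr \<nu> * struve_L (m + 3) x) - (n + 1) * (x powr \<nu> * (K * x powr (m + 2))))"
      unfolding d_def 1 2 3 by (simp only: pser_cmult pser_diff ent)
    also have "\<dots> = x powr \<nu> / (A + 1) * (2 * (m + 1) * struve_L (m + 1) x
        - (n + 1) * struve_L (m + 3) x - (n + 1) * (K * x powr (m + 2)))"
      by (simp add: algebra_simps diff_divide_distrib add_divide_distrib)
    also have "\<dots> = B x"
      by (simp add: B_def A_def m_def K_def)
    finally show ?thesis by simp
  qed
  \<comment> \<open>The last quotient is the right-hand side of
    \<open>upper_coeff_inequality\<close> at \<open>s = 2 * k + A + n + 3\<close>.\<close>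
  define r where "r k = (A + 2 + 2 * real k) *
      (((A + 1) * (2 * real k + A + n + 3 + 2) + (n + 1) * (A + n + 4)) /
       ((A + 1) * (2 * real k + A + n + 3) * (2 * real k + A + n + 3 + 2)))" for k
  have u_eq: "?u k = struve_coeff m k / (2 * real k + A + n + 3)" for k
    using struve_coeff_order_Suc[OF m', of k] m2 by (simp add: algebra_simps)
  have d_Suc: "d k = r k * ?a k" if "k > 0" for k
  proof -
    obtain j where j: "k = Suc j" using \<open>k > 0\<close> gr0_conv_Suc by blast
    define s where "s = 2 * real k + A + n + 3"
    have s: "s > 0" using A assms(1) by (simp add: s_def)
    \<comment> \<open>Two steps in the order and one in the index express the shifted term through
      \<open>?u k\<close>, so that \<open>d k\<close> becomes a multiple of \<open>?u k\<close>
      alone.\<close>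
    have 2: "struve_coeff (m + 2) j = struve_coeff (m + 1) j / s"
      using struve_coeff_order_Suc[of "m + 1" j] m m2 by (simp add: s_def j algebra_simps)
    have 3: "struve_coeff (m + 3) j = struve_coeff (m + 2) j / (s + 2)"
      using struve_coeff_order_Suc[of "m + 2" j] m m2 by (simp add: s_def j algebra_simps)
    have "2 * real j + 2 * (m + 1) + 3 = s" "2 * real j + 3 = 2 * real k + 1"
      using m2 by (simp_all add: s_def j)
    then have 4: "struve_coeff (m + 1) k = struve_coeff (m + 1) j / ((2 * real k + 1) * s)"
      using struve_coeff_Suc[of "m + 1" j] m by (simp add: j)
    have v: "struve_coeff (m + 3) j = (2 * real k + 1) * ?u k / (s + 2)"
      unfolding 2 3 4 using s by simp
    have "d k = 1 / (A + 1) * ((A + n + 2) * ?u k - (n + 1) * ((2 * real k + 1) * ?u k / (s + 2)))"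
      unfolding d_def using m2 by (simp add: j v[unfolded j])
    also have "\<dots> = ((A + n + 2) * (s + 2) - (n + 1) * (2 * real k + 1)) / ((A + 1) * (s + 2)) * ?u k"
    proof -
      have "1 / a * (b * u - c * (e * u / t)) = (b * t - c * e) / (a * t) * u"
        if "a > 0" "t > 0" for a b c e t u :: real
        using that by (simp add: field_simps)
      from this[of "A + 1" "s + 2"] show ?thesis using s A by simp
    qed
    also have "(A + n + 2) * (s + 2) - (n + 1) * (2 * real k + 1)
        = (A + 1) * (s + 2) + (n + 1) * (A + n + 4)"
      by (simp add: s_def algebra_simps)
    also have "\<dots> / ((A + 1) * (s + 2)) * ?u k
        = ((A + 1) * (s + 2) + (n + 1) * (A + n + 4)) / ((A + 1) * s * (s + 2)) * struve_coeff m k"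
      unfolding u_eq s_def[symmetric] using s A by simp
    also have "\<dots> = r k * ?a k"
      unfolding r_def s_def[symmetric] using A add_pos_nonneg[of "A + 2" "2 * real k"] by simp
    finally show ?thesis .
  qed
  \<comment> \<open>The elementary term is what makes the zeroth coefficients equal; strictness is
    therefore taken from index \<open>1\<close> below.\<close>
  have d_0: "d 0 = ?a 0"
  proof -
    have 1: "rGamma (m + 5 / 2) = rGamma (m + 3 / 2) / (m + 3 / 2)"
      using rGamma_shift[of "m + 3 / 2"] m by (simp add: add_ac)
    have "rGamma (3 / 2 :: real) = rGamma (1 / 2) / (1 / 2)"
      using rGamma_shift[of "1 / 2 :: real"] by simp
    also have "rGamma (1 / 2 :: real) = 1 / sqrt pi"
      unfolding rGamma_inverse_Gamma Gamma_one_half_real by (rule inverse_eq_divide)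
    finally have 2: "rGamma (3 / 2 :: real) = 2 / sqrt pi"
      by simp
    have 3: "struve_coeff m 0 = 2 / sqrt pi * rGamma (m + 3 / 2) / 2 powr (m + 1)"
      unfolding struve_coeff_def 2[symmetric] by simp
    have "K = rGamma (m + 5 / 2) / (sqrt pi * 2 powr (m + 1) * (A + 2))"
      unfolding K_def rGamma_inverse_Gamma by (simp add: field_simps)
    then have "K = struve_coeff m 0 / (2 * ((m + 3 / 2) * (A + 2)))"
      unfolding 1 3 by simp
    also have "\<dots> = struve_coeff m 0 / ((A + n + 3) * (A + 2))"
      using m2 by (simp add: algebra_simps)
    finally have K: "K = struve_coeff m 0 / ((A + n + 3) * (A + 2))" .
    have p: "A + n + 3 > 0" "A + 2 > 0" "A + 1 > 0" using A assms(1) by auto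
    have "d 0 = 1 / (A + 1) * ((A + n + 2) * (struve_coeff m 0 / (A + n + 3))
        - (n + 1) * (struve_coeff m 0 / ((A + n + 3) * (A + 2))))"
      unfolding d_def u_eq K using m2 by simp
    also have "\<dots> = struve_coeff m 0 * (((A + n + 2) * (A + 2) - (n + 1)) / ((A + 1) * (A + n + 3) * (A + 2)))"
    proof -
      have "1 / a * (b * (s / u) - c * (s / (u * t))) = s * ((b * t - c) / (a * u * t))"
        if "a > 0" "t > 0" "u > 0" for a b c s t u :: real
        using that by (simp add: field_simps)
      then show ?thesis using p by blast
    qed
    also have "(A + n + 2) * (A + 2) - (n + 1) = (A + 1) * (A + n + 3)"
      by (simp add: algebra_simps)
    finally show ?thesis using p by simp
  qed
  have a_pos: "?a k > 0" for k
    using A struve_coeff_pos[OF m', of k] by simp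
  have r: "1 < r k" if "k > 0" for k
  proof -
    define s where "s = 2 * real k + A + n + 3"
    have s: "A + 2 + 2 * real k = s - n - 1" "s - n - 1 > 0"
      using A by (simp_all add: s_def)
    have "1 / (s - n - 1) < ((A + 1) * (s + 2) + (n + 1) * (A + n + 4)) / ((A + 1) * s * (s + 2))"
      by (rule upper_coeff_inequality[OF A assms(1)]) (use that in \<open>simp add: s_def\<close>)
    from mult_strict_left_mono[OF this s(2)] show ?thesis
      unfolding r_def s_def[symmetric] s(1) using s(2) by simp
  qed
  then have less: "?a k < d k" if "k > 0" for k
    using d_Suc[OF that] mult_strict_right_mono[OF r[OF that] a_pos[of k]] by simp
  show "J x < B x"
    unfolding J[OF assms(3)] B[OF assms(3)]
  proof (rule pser_less[OF a d _ less[OF zero_less_one] assms(3)])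
    show "?a k \<le> d k" for k
      using less[of k] d_0 by (cases "k = 0") auto
  qed
  assume c: "0 < c" "c < 1"
  have "r \<longlonglongrightarrow> 1"
  proof -
    define C where "C = (n + 1) * (A + n + 4) / (A + 1)"
    have "((A + 1) * (s + 2) + (n + 1) * (A + n + 4)) / ((A + 1) * s * (s + 2)) = (s + 2 + C) / (s * (s + 2))" for s
    proof -
      have "(A + 1) * (s + 2) + (n + 1) * (A + n + 4) = (A + 1) * (s + 2 + C)"
        unfolding C_def distrib_left[of "A + 1"] using A by simp
      then show ?thesis using A by (simp add: mult.assoc)
    qed
    then have "r = (\<lambda>k. (A + 2 + 2 * real k) * ((2 * real k + A + n + 3 + 2 + C) /
        ((2 * real k + A + n + 3) * (2 * real k + A + n + 3 + 2))))"
      unfolding r_def by presburger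
    moreover have "\<dots> \<longlonglongrightarrow> 1"
      by real_asymp
    ultimately show ?thesis by simp
  qed
  then have "\<forall>\<^sub>F k in sequentially. r k < 1 / c"
    by (rule order_tendstoD) (use c in simp)
  then have "\<forall>\<^sub>F k in sequentially. c * d k < ?a k"
    using eventually_gt_at_top[of 0]
  proof eventually_elim
    case (elim k)
    have "c * r k < 1" using elim(1) c by (simp add: field_simps)
    from mult_strict_right_mono[OF this a_pos[of k]] show ?case
      using elim(2) by (simp add: d_Suc mult.assoc)
  qed
  then have "\<forall>\<^sub>F x in at_top. pser (A + 2) (\<lambda>k. c * d k) x < pser (A + 2) ?a x"
    by (intro eventually_pser_less a entire_coeffs_cmult d)
  then show "\<forall>\<^sub>F x in at_top. c * B x < J x"
    using eventually_gt_at_top[of 0]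
    by eventually_elim (simp add: J B pser_cmult[OF d])
qed

section \<open>Bounds for orders at least 1/2\<close>

lemma struve_continuous:
  assumes "\<nu> \<ge> 1 / 2"
  shows "continuous_on {0..} (\<lambda>t. t powr \<nu> * struve_L \<nu> t)"
proof -
  have "continuous_on {0..} (pser (2 * \<nu> + 1) (struve_coeff \<nu>))"
    using assms by (intro continuous_on_pser entire_struve_coeff) auto
  then show ?thesis
    using assms by (subst continuous_on_cong[OF refl struve_L_pser]) (auto simp: algebra_simps)
qed

text \<open>The difference \<open>h\<close> of the two sides vanishes at \<open>0\<close> and has
  derivative \<open>g' - g\<close>, which is positive.\<close>

lemma struve_integral_less:
  assumes nu: "\<nu> \<ge> 1 / 2" and x: "x > 0"
  defines "f \<equiv> \<lambda>t. t powr \<nu> * struve_L \<nu> t"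
  shows "integral {0..x} f < f x"
proof -
  define g where "g = pser (2 * \<nu> + 1) (struve_coeff \<nu>)"
  define g' where "g' = pser (2 * \<nu>) (struve_coeff (\<nu> - 1))"
  have e: "entire_coeffs (struve_coeff \<nu>)"
    using nu by (intro entire_struve_coeff) auto
  have f: "f t = g t" if "t \<ge> 0" for t
    unfolding f_def g_def using struve_L_pser[of \<nu> t \<nu>] nu that by (simp add: algebra_simps)
  have cont: "continuous_on {0..} g"
    unfolding g_def using nu by (intro continuous_on_pser e) auto
  define h where "h = (\<lambda>y. g y - integral {0..y} g)"
  have "h 0 < h x"
  proof (rule DERIV_pos_imp_increasing_open[OF x])
    fix y assume y: "0 < y" "y < x"
    have "((\<lambda>y. integral {0..y} g) has_real_derivative g y) (at y)"
      using damped_integral_has_derivative[OF cont y(1), of 0] by simp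
    moreover have "(g has_real_derivative g' y) (at y)"
      unfolding g_def g'_def using nu y by (intro has_real_derivative_pser_struve) auto
    ultimately have "(h has_real_derivative g' y - g y) (at y)"
      unfolding h_def by (rule DERIV_diff[rotated])
    moreover have "g y < g' y"
      unfolding g_def g'_def by (rule pser_struve_less_derivative[OF nu y(1)])
    ultimately show "\<exists>d. (h has_real_derivative d) (at y) \<and> d > 0"
      by (intro exI[of _ "g' y - g y"]) simp
  next
    show "continuous_on {0..x} h"
      unfolding h_def
      by (intro continuous_intros indefinite_integral_continuous_1 integrable_continuous_real
            continuous_on_subset[OF cont]) auto
  qed
  then have "integral {0..x} g < g x"
    by (simp add: h_def g_def pser_def)
  moreover have "integral {0..x} f = integral {0..x} g"
    by (rule integral_cong) (simp add: f)
  ultimately show ?thesis using f[of x] x by simp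
qed

lemma struve_growth:
  assumes nu: "\<nu> \<ge> 1 / 2" and x: "x > 0"
  shows "x powr \<nu> * struve_L \<nu> x \<le> struve_coeff \<nu> 0 * x powr (2 * \<nu> + 1) * exp x"
  using pser_struve_coeff_le_exp[of \<nu> x "2 * \<nu> + 1"] struve_L_pser[of \<nu> x \<nu>] assms
  by (simp add: algebra_simps)

lemma struve_integral_pos:
  assumes "\<nu> \<ge> 1 / 2" "x > 0"
  shows "0 < integral {0..x} (\<lambda>t. t powr \<nu> * struve_L \<nu> t)"
  using struve_damped_bounds(1)[of \<nu> \<nu> 0 x] assms by simp

lemma struve_integral_has_derivative:
  assumes "\<nu> \<ge> 1 / 2" "x > 0"
  shows "((\<lambda>x. integral {0..x} (\<lambda>t. t powr \<nu> * struve_L \<nu> t)) has_real_derivative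
    x powr \<nu> * struve_L \<nu> x) (at x)"
  using damped_integral_has_derivative[OF struve_continuous[OF assms(1)] assms(2), of 0] by simp

text \<open>Otherwise \<open>F < c * F'\<close> on the whole half-line, so \<open>F\<close> would
  grow at rate \<open>1 / c > 1\<close>, although \<open>F < f\<close> and \<open>f\<close> is at
  most a power times \<open>exp x\<close>.\<close>

lemma struve_integral_less_best:
  assumes nu: "\<nu> \<ge> 1 / 2" and c: "0 < c" "c < 1"
  shows "\<exists>x>0. c * (x powr \<nu> * struve_L \<nu> x) \<le> integral {0..x} (\<lambda>t. t powr \<nu> * struve_L \<nu> t)"
proof (rule ccontr)
  define f where "f = (\<lambda>x. x powr \<nu> * struve_L \<nu> x)"
  define F where "F = (\<lambda>x. integral {0..x} f)"
  assume "\<not> ?thesis"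
  then have less: "F x < c * f x" if "x > 0" for x
    using that by (force simp: F_def f_def not_le)
  show False
  proof (rule exponential_growth_contradiction[where G = F and G' = f and X = 1 and \<kappa> = "1 / c"
        and K = "struve_coeff \<nu> 0" and q = "2 * \<nu> + 1" and \<rho> = 1])
    fix x :: real assume x: "x \<ge> 1"
    show "(F has_real_derivative f x) (at x)"
      unfolding F_def f_def using nu x by (intro struve_integral_has_derivative) auto
    show "1 / c * F x \<le> f x"
      using less[of x] c x by (simp add: field_simps)
    have "F x \<le> f x"
      using struve_integral_less[OF nu, of x] x by (simp add: F_def f_def)
    also have "\<dots> \<le> struve_coeff \<nu> 0 * x powr (2 * \<nu> + 1) * exp (1 * x)"
      using struve_growth[OF nu, of x] x by (simp add: f_def)
    finally show "F x \<le> struve_coeff \<nu> 0 * x powr (2 * \<nu> + 1) * exp (1 * x)" .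
  next
    show "F 1 > 0"
      using struve_integral_pos[OF nu, of 1] by (simp add: F_def f_def)
    show "1 < 1 / c" using c by simp
  qed
qed

text \<open>The damped integral lemmas are applied to the undamped integral \<open>F\<close> and its
  derivative \<open>f\<close>; the required \<open>F < f\<close> is bound (2), which also passes the
  growth estimate from \<open>f\<close> to \<open>F\<close>.\<close>

lemma struve_damped_integral_upper:
  assumes nu: "\<nu> \<ge> 1 / 2" and \<gamma>: "0 \<le> \<gamma>" "\<gamma> < 1"
  defines "I \<equiv> \<lambda>x. integral {0..x} (\<lambda>t. exp (- \<gamma> * t) * t powr \<nu> * struve_L \<nu> t)"
    and "B \<equiv> \<lambda>x. exp (- \<gamma> * x) / (1 - \<gamma>) * integral {0..x} (\<lambda>t. t powr \<nu> * struve_L \<nu> t)"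
  shows "\<gamma> = 0 \<Longrightarrow> I x = B x"
    and "x > 0 \<Longrightarrow> \<gamma> > 0 \<Longrightarrow> I x < B x"
    and "0 < c \<Longrightarrow> c < 1 \<Longrightarrow> \<exists>x>X. c * B x < I x"
proof -
  define f where "f = (\<lambda>t. t powr \<nu> * struve_L \<nu> t)"
  define F where "F = (\<lambda>x. integral {0..x} f)"
  have I: "I = (\<lambda>x. integral {0..x} (\<lambda>t. exp (- \<gamma> * t) * f t))"
    unfolding I_def f_def by (simp add: mult.assoc)
  have B: "B = (\<lambda>x. exp (- \<gamma> * x) / (1 - \<gamma>) * F x)"
    unfolding B_def F_def f_def ..
  have cont: "continuous_on {0..} f"
    unfolding f_def by (rule struve_continuous[OF nu])
  have pos: "F y > 0" and less: "F y < f y" and growth: "f y \<le> struve_coeff \<nu> 0 * y powr (2 * \<nu> + 1) * exp y"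
    and deriv: "(F has_real_derivative f y) (at y)" if "y > 0" for y
    unfolding F_def f_def
    using that nu by (auto intro: struve_integral_pos struve_integral_less struve_growth struve_integral_has_derivative)
  show "I x = B x" if "\<gamma> = 0"
    using that by (simp add: I B F_def)
  show "I x < B x" if "x > 0" "\<gamma> > 0"
  proof -
    have "continuous_on {0..} F"
      unfolding continuous_on_eq_continuous_within
    proof
      fix y :: real assume "y \<in> {0..}"
      have "continuous_on {0..y + 1} F"
        unfolding F_def
        by (intro indefinite_integral_continuous_1 integrable_continuous_real continuous_on_subset[OF cont]) auto
      then have "continuous (at y within {0..y + 1}) F"
        using \<open>y \<in> {0..}\<close> by (auto simp: continuous_on_eq_continuous_within)
      moreover have "at y within {0..y + 1} = at y within {0..}"
        by (rule at_within_nhd[of _ "{..<y + 1}"]) auto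
      ultimately show "continuous (at y within {0..}) F" by simp
    qed
    from damped_integral_upper[OF this cont deriv _ less that(2,1)]
    have "(1 - \<gamma>) * I x < exp (- \<gamma> * x) * F x" by (simp add: I F_def)
    then show ?thesis using \<gamma> by (simp add: B less_divide_eq mult.commute)
  qed
  show "\<exists>x>X. c * B x < I x" if "0 < c" "c < 1"
    unfolding I B
  proof (rule damped_integral_upper_best[OF cont pos less _ \<gamma>(2) that])
    show "F y \<le> struve_coeff \<nu> 0 * y powr (2 * \<nu> + 1) * exp y" if "y > 0" for y
      using less[OF that] growth[OF that] by simp
  qed
qed

section \<open>Bounds with the factor \<open>t powr (\<nu> + 1)\<close>\<close>

text \<open>For this power of \<open>t\<close>, integration divides by
  \<open>2 * \<nu> + 3 + 2 * k\<close>, exactly the factor of raising the order. Hence the equality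
  cases at \<open>\<gamma> = 0\<close>.\<close>

lemma struve_shifted_integral:
  assumes "\<nu> > - 3 / 2" "x > 0"
  shows "integral {0..x} (\<lambda>t. t powr (\<nu> + 1) * struve_L \<nu> t) = x powr (\<nu> + 1) * struve_L (\<nu> + 1) x"
proof -
  have "(\<lambda>k. struve_coeff \<nu> k / ((\<nu> + 1) + \<nu> + 2 + 2 * real k)) = struve_coeff (\<nu> + 1)"
    using struve_coeff_order_Suc[OF assms(1)] by (auto simp: algebra_simps)
  then show ?thesis
    using integral_unique[OF struve_has_integral(1)[OF assms(1), of "\<nu> + 1" x]]
      struve_L_pser[of "\<nu> + 1" x "\<nu> + 1"] assms
    by (simp add: algebra_simps)
qed

text \<open>The pair \<open>g\<close>, \<open>g'\<close> belongs to the order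
  \<open>\<nu> + 1\<close>, which exceeds \<open>1 / 2\<close>, so that \<open>g < g'\<close> is
  available.\<close>

lemma struve_shifted_damped_upper:
  assumes nu: "\<nu> > - 1 / 2" and \<gamma>: "0 \<le> \<gamma>" "\<gamma> < 1"
  defines "I \<equiv> \<lambda>x. integral {0..x} (\<lambda>t. exp (- \<gamma> * t) * t powr (\<nu> + 1) * struve_L \<nu> t)"
    and "B \<equiv> \<lambda>x. 1 / (1 - \<gamma>) * exp (- \<gamma> * x) * x powr (\<nu> + 1) * struve_L (\<nu> + 1) x"
  shows "x > 0 \<Longrightarrow> \<gamma> = 0 \<Longrightarrow> I x = B x"
    and "x > 0 \<Longrightarrow> \<gamma> > 0 \<Longrightarrow> I x < B x"
    and "0 < c \<Longrightarrow> c < 1 \<Longrightarrow> \<exists>x>0. c * B x < I x"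
proof -
  define g where "g = pser (2 * (\<nu> + 1) + 1) (struve_coeff (\<nu> + 1))"
  define g' where "g' = pser (2 * (\<nu> + 1)) (struve_coeff \<nu>)"
  have e: "entire_coeffs (struve_coeff (\<nu> + 1))" "entire_coeffs (struve_coeff \<nu>)"
    using nu by (auto intro: entire_struve_coeff)
  have I: "I y = integral {0..y} (\<lambda>t. exp (- \<gamma> * t) * g' t)" for y
    unfolding I_def
  proof (rule integral_cong)
    show "exp (- \<gamma> * t) * t powr (\<nu> + 1) * struve_L \<nu> t = exp (- \<gamma> * t) * g' t" if "t \<in> {0..y}" for t
      using struve_L_pser[of \<nu> t "\<nu> + 1"] nu that by (simp add: g'_def algebra_simps)
  qed
  have B: "B y = exp (- \<gamma> * y) / (1 - \<gamma>) * g y" if "y > 0" for y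
  proof -
    have "(\<nu> + 1) + (\<nu> + 1) + 1 = 2 * (\<nu> + 1) + 1" by simp
    then have "y powr (\<nu> + 1) * struve_L (\<nu> + 1) y = g y"
      using struve_L_pser[of "\<nu> + 1" y "\<nu> + 1"] nu that by (simp only: g_def)
    then show ?thesis by (simp add: B_def mult.assoc)
  qed
  have cont: "continuous_on {0..} g" "continuous_on {0..} g'"
    unfolding g_def g'_def using nu by (intro continuous_on_pser e; simp)+
  have deriv: "(g has_real_derivative g' y) (at y)" if "y > 0" for y
    unfolding g_def g'_def using has_real_derivative_pser_struve[of "\<nu> + 1" y] nu that by simp
  have less: "g y < g' y" if "y > 0" for y
    unfolding g_def g'_def using pser_struve_less_derivative[of "\<nu> + 1" y] nu that by simp
  have pos: "g y > 0" if "y > 0" for y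
    unfolding g_def using nu that
    by (intro pser_pos[where j = 0] e less_imp_le[OF struve_coeff_pos] struve_coeff_pos) auto
  show "I x = B x" if "x > 0" "\<gamma> = 0"
    using struve_shifted_integral[of \<nu> x] nu that by (simp add: I_def B_def)
  show "I x < B x" if "x > 0" "\<gamma> > 0"
  proof -
    have "g 0 = 0" by (simp add: g_def pser_def)
    from damped_integral_upper[OF cont deriv this less that(2,1)]
    have "(1 - \<gamma>) * I x < exp (- \<gamma> * x) * g x" by (simp add: I)
    then show ?thesis using \<gamma> that by (simp add: B less_divide_eq mult.commute)
  qed
  show "\<exists>x>0. c * B x < I x" if "0 < c" "c < 1"
  proof -
    have "\<exists>x>0. c * (exp (- \<gamma> * x) / (1 - \<gamma>) * g x) < integral {0..x} (\<lambda>t. exp (- \<gamma> * t) * g' t)"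
    proof (rule damped_integral_upper_best[OF cont(2) pos less _ \<gamma>(2) that])
      show "g y \<le> struve_coeff (\<nu> + 1) 0 * y powr (2 * (\<nu> + 1) + 1) * exp y" if "y > 0" for y
        unfolding g_def using nu that by (intro pser_struve_coeff_le_exp) auto
    qed
    then show ?thesis using B I by auto
  qed
qed

section \<open>Assembly of the seven bounds\<close>

lemma eventually_at_top_positive_witness:
  fixes P :: "real \<Rightarrow> bool"
  assumes "\<forall>\<^sub>F x in at_top. P x"
  obtains x where "x > 0" "P x"
proof -
  obtain N where "\<And>x. x \<ge> N \<Longrightarrow> P x"
    using assms by (auto simp: eventually_at_top_linorder)
  then show ?thesis using that[of "max N 1"] by simp
qed

text \<open>The condition \<open>\<gamma> < 1\<close> accompanies the bounds that divide by
  \<open>1 - \<gamma>\<close>. In the last bound both sides coincide at \<open>\<gamma> = 0\<close>,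
  so strictness is claimed for \<open>\<gamma> > 0\<close>; its sharpness is stated for
  \<open>\<le>\<close>, which is stronger than for \<open><\<close>.\<close>

theorem theorem2p1:
  fixes \<nu> n \<gamma> :: real
  assumes "n > -1" and "\<gamma> \<ge> 0"
  shows
   "(\<nu> > - (n + 2) / 2 \<longrightarrow>
      (let I = (\<lambda>x. integral {0..x} (\<lambda>t. exp (- \<gamma> * t) * t powr \<nu> * struve_L (\<nu> + n) t));
           B = (\<lambda>x. exp (- \<gamma> * x) * x powr \<nu> * struve_L (\<nu> + n + 1) x)
       in (\<forall>x>0. I x > B x) \<and>
          (\<gamma> = 0 \<longrightarrow> best_lower_constant (>) I B)))
    \<and>
    (\<nu> \<ge> 1 / 2 \<longrightarrow>
      (let I = (\<lambda>x. integral {0..x} (\<lambda>t. t powr \<nu> * struve_L \<nu> t));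
           B = (\<lambda>x. x powr \<nu> * struve_L \<nu> x)
       in (\<forall>x>0. I x < B x) \<and>
          best_upper_constant (<) I B))
    \<and>
    (\<nu> > - (n + 1) / 2 \<longrightarrow>
      (let I = (\<lambda>x. integral {0..x} (\<lambda>t. t powr \<nu> * struve_L (\<nu> + n) t));
           B = (\<lambda>x. x powr \<nu> / (2 * \<nu> + n + 1) *
                  (2 * (\<nu> + n + 1) * struve_L (\<nu> + n + 1) x
                   - (n + 1) * struve_L (\<nu> + n + 3) x
                   - (n + 1) * x powr (\<nu> + n + 2) /
                     (sqrt pi * 2 powr (\<nu> + n + 1) * (2 * \<nu> + n + 2) * Gamma (\<nu> + n + 5 / 2))))
       in (\<forall>x>0. I x < B x) \<and>
          best_upper_constant (<) I B))
    \<and>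
    (\<gamma> < 1 \<and> \<nu> \<ge> 1 / 2 \<longrightarrow>
      (let I = (\<lambda>x. integral {0..x} (\<lambda>t. exp (- \<gamma> * t) * t powr \<nu> * struve_L \<nu> t));
           B = (\<lambda>x. exp (- \<gamma> * x) / (1 - \<gamma>) * integral {0..x} (\<lambda>t. t powr \<nu> * struve_L \<nu> t))
       in (\<forall>x>0. I x \<le> B x \<and> (I x = B x \<longleftrightarrow> \<gamma> = 0)) \<and>
          best_upper_constant (\<le>) I B))
    \<and>
    (\<gamma> < 1 \<and> \<nu> \<ge> 1 / 2 \<longrightarrow>
      (let I = (\<lambda>x. integral {0..x} (\<lambda>t. exp (- \<gamma> * t) * t powr \<nu> * struve_L \<nu> t));
           B = (\<lambda>x. exp (- \<gamma> * x) * x powr \<nu> / ((2 * \<nu> + 1) * (1 - \<gamma>)) *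
                  (2 * (\<nu> + 1) * struve_L (\<nu> + 1) x
                   - struve_L (\<nu> + 3) x
                   - x powr (\<nu> + 2) /
                     (sqrt pi * 2 powr (\<nu> + 2) * (\<nu> + 1) * Gamma (\<nu> + 5 / 2))))
       in (\<forall>x>0. I x < B x) \<and>
          best_upper_constant (<) I B))
    \<and>
    (\<nu> > - 3 / 2 \<longrightarrow>
      (let I = (\<lambda>x. integral {0..x} (\<lambda>t. exp (- \<gamma> * t) * t powr (\<nu> + 1) * struve_L \<nu> t));
           B = (\<lambda>x. exp (- \<gamma> * x) * x powr (\<nu> + 1) * struve_L (\<nu> + 1) x)
       in (\<forall>x>0. I x \<ge> B x \<and> (I x = B x \<longleftrightarrow> \<gamma> = 0)) \<and>
          best_lower_constant (\<ge>) I B))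
    \<and>
    (\<gamma> < 1 \<and> \<nu> > - 1 / 2 \<longrightarrow>
      (let I = (\<lambda>x. integral {0..x} (\<lambda>t. exp (- \<gamma> * t) * t powr (\<nu> + 1) * struve_L \<nu> t));
           B = (\<lambda>x. 1 / (1 - \<gamma>) * exp (- \<gamma> * x) * x powr (\<nu> + 1) * struve_L (\<nu> + 1) x)
       in (\<forall>x>0. I x \<le> B x \<and> (\<gamma> > 0 \<longrightarrow> I x < B x)) \<and>
          best_upper_constant (\<le>) I B))"
proof (intro conjI impI; unfold Let_def)
  let ?I = "\<lambda>\<mu> \<nu> x. integral {0..x} (\<lambda>t. exp (- \<gamma> * t) * t powr \<nu> * struve_L \<mu> t)"
  let ?J = "\<lambda>\<mu> \<nu> x. integral {0..x} (\<lambda>t. t powr \<nu> * struve_L \<mu> t)"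
  assume nu: "\<nu> > - (n + 2) / 2"
  \<comment> \<open>Adding \<open>n\<close> gives
    \<open>\<nu> + n > n / 2 - 1 > - 3 / 2\<close>.\<close>
  have \<mu>: "\<nu> + n > - 3 / 2" "\<nu> + (\<nu> + n) + 2 > 0"
    using nu assms(1) by (simp_all add: field_simps)
  show "(\<forall>x>0. ?I (\<nu> + n) \<nu> x > exp (- \<gamma> * x) * x powr \<nu> * struve_L (\<nu> + n + 1) x) \<and>
    (\<gamma> = 0 \<longrightarrow> best_lower_constant (>) (?I (\<nu> + n) \<nu>)
      (\<lambda>x. exp (- \<gamma> * x) * x powr \<nu> * struve_L (\<nu> + n + 1) x))"
  proof (intro conjI allI impI)
    fix x :: real assume x: "x > 0"
    have "exp (- \<gamma> * x) * (x powr \<nu> * struve_L (\<nu> + n + 1) x) < exp (- \<gamma> * x) * ?J (\<nu> + n) \<nu> x"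
      using struve_integral_lower(1)[OF assms(1) nu x] by simp
    also have "\<dots> \<le> ?I (\<nu> + n) \<nu> x"
      by (rule struve_damped_bounds(3)[OF \<mu> assms(2) x])
    finally show "?I (\<nu> + n) \<nu> x > exp (- \<gamma> * x) * x powr \<nu> * struve_L (\<nu> + n + 1) x"
      by (simp add: mult.assoc)
  next
    assume \<gamma>: "\<gamma> = 0"
    show "best_lower_constant (>) (?I (\<nu> + n) \<nu>)
      (\<lambda>x. exp (- \<gamma> * x) * x powr \<nu> * struve_L (\<nu> + n + 1) x)"
      unfolding best_lower_constant_def
    proof (intro allI impI)
      fix c :: real assume "c > 1"
      from struve_integral_lower(2)[OF assms(1) nu zero_less_one this]
      obtain x where "x > 0" "?J (\<nu> + n) \<nu> x < c * (x powr \<nu> * struve_L (\<nu> + n + 1) x)"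
        by (rule eventually_at_top_positive_witness)
      then show "\<exists>x>0. \<not> ?I (\<nu> + n) \<nu> x > c * (exp (- \<gamma> * x) * x powr \<nu> * struve_L (\<nu> + n + 1) x)"
        using \<gamma> by (intro exI[of _ x]) simp
    qed
  qed
next
  assume nu: "\<nu> \<ge> 1 / 2"
  show "(\<forall>x>0. integral {0..x} (\<lambda>t. t powr \<nu> * struve_L \<nu> t) < x powr \<nu> * struve_L \<nu> x) \<and>
    best_upper_constant (<) (\<lambda>x. integral {0..x} (\<lambda>t. t powr \<nu> * struve_L \<nu> t))
      (\<lambda>x. x powr \<nu> * struve_L \<nu> x)"
    using struve_integral_less[OF nu] struve_integral_less_best[OF nu]
    unfolding best_upper_constant_def not_less by blast
next
  let ?J = "\<lambda>x. integral {0..x} (\<lambda>t. t powr \<nu> * struve_L (\<nu> + n) t)"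
  let ?B = "\<lambda>x. x powr \<nu> / (2 * \<nu> + n + 1) *
                  (2 * (\<nu> + n + 1) * struve_L (\<nu> + n + 1) x
                   - (n + 1) * struve_L (\<nu> + n + 3) x
                   - (n + 1) * x powr (\<nu> + n + 2) /
                     (sqrt pi * 2 powr (\<nu> + n + 1) * (2 * \<nu> + n + 2) * Gamma (\<nu> + n + 5 / 2)))"
  assume nu: "\<nu> > - (n + 1) / 2"
  show "(\<forall>x>0. ?J x < ?B x) \<and> best_upper_constant (<) ?J ?B"
    unfolding best_upper_constant_def
  proof (intro conjI allI impI)
    fix c :: real assume c: "0 < c \<and> c < 1"
    from struve_integral_upper(2)[OF assms(1) nu zero_less_one conjunct1[OF c] conjunct2[OF c]]
    obtain x where "x > 0" "c * ?B x < ?J x"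
      by (rule eventually_at_top_positive_witness)
    then show "\<exists>x>0. \<not> ?J x < c * ?B x"
      by (intro exI[of _ x]) simp
  qed (rule struve_integral_upper(1)[OF assms(1) nu])
next
  let ?I = "\<lambda>x. integral {0..x} (\<lambda>t. exp (- \<gamma> * t) * t powr \<nu> * struve_L \<nu> t)"
  let ?B = "\<lambda>x. exp (- \<gamma> * x) / (1 - \<gamma>) * integral {0..x} (\<lambda>t. t powr \<nu> * struve_L \<nu> t)"
  assume a: "\<gamma> < 1 \<and> \<nu> \<ge> 1 / 2"
  then have nu: "\<nu> \<ge> 1 / 2" and \<gamma>: "\<gamma> < 1" by auto
  note b = struve_damped_integral_upper[OF nu assms(2) \<gamma>]
  show "(\<forall>x>0. ?I x \<le> ?B x \<and> (?I x = ?B x \<longleftrightarrow> \<gamma> = 0)) \<and> best_upper_constant (\<le>) ?I ?B"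
    unfolding best_upper_constant_def
  proof (intro conjI[of "\<forall>x>0. ?I x \<le> ?B x \<and> (?I x = ?B x \<longleftrightarrow> \<gamma> = 0)"] allI impI)
    fix x :: real assume "x > 0"
    then show "?I x \<le> ?B x \<and> (?I x = ?B x \<longleftrightarrow> \<gamma> = 0)"
      using b(1,2)[of x] assms(2) by (cases "\<gamma> = 0") (auto simp del: times_divide_eq_left)
  next
    fix c :: real assume "0 < c \<and> c < 1"
    then show "\<exists>x>0. \<not> ?I x \<le> c * ?B x"
      using b(3)[of c 0] unfolding not_le by blast
  qed
next
  let ?I = "\<lambda>x. integral {0..x} (\<lambda>t. exp (- \<gamma> * t) * t powr \<nu> * struve_L \<nu> t)"
  let ?J = "\<lambda>x. integral {0..x} (\<lambda>t. t powr \<nu> * struve_L \<nu> t)"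
  \<comment> \<open>Bound (3) at \<open>n = 0\<close>, with the zeros kept so that it is a literal
    instance.\<close>
  let ?B3 = "\<lambda>x. x powr \<nu> / (2 * \<nu> + 0 + 1) *
                  (2 * (\<nu> + 0 + 1) * struve_L (\<nu> + 0 + 1) x
                   - (0 + 1) * struve_L (\<nu> + 0 + 3) x
                   - (0 + 1) * x powr (\<nu> + 0 + 2) /
                     (sqrt pi * 2 powr (\<nu> + 0 + 1) * (2 * \<nu> + 0 + 2) * Gamma (\<nu> + 0 + 5 / 2)))"
  let ?B = "\<lambda>x. exp (- \<gamma> * x) * x powr \<nu> / ((2 * \<nu> + 1) * (1 - \<gamma>)) *
                  (2 * (\<nu> + 1) * struve_L (\<nu> + 1) x
                   - struve_L (\<nu> + 3) x
                   - x powr (\<nu> + 2) /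
                     (sqrt pi * 2 powr (\<nu> + 2) * (\<nu> + 1) * Gamma (\<nu> + 5 / 2)))"
  assume a: "\<gamma> < 1 \<and> \<nu> \<ge> 1 / 2"
  then have nu: "\<nu> \<ge> 1 / 2" and \<gamma>: "\<gamma> < 1" by auto
  have nu0: "\<nu> > - (0 + 1) / 2" and n0: "0 > (-1::real)" using nu by auto
  have B: "?B x = exp (- \<gamma> * x) / (1 - \<gamma>) * ?B3 x" for x
  proof -
    have "2 powr (\<nu> + 2) = 2 powr (\<nu> + 1) * (2::real)"
      using powr_add[of 2 "\<nu> + 1" "1::real"] by (simp add: add.assoc)
    then have eq: "sqrt pi * 2 powr (\<nu> + 2) * (\<nu> + 1) * Gamma (\<nu> + 5 / 2)
        = sqrt pi * 2 powr (\<nu> + 1) * (2 * \<nu> + 2) * Gamma (\<nu> + 5 / 2)"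
      by (simp add: algebra_simps)
    show ?thesis
      unfolding eq by (simp add: mult_ac)
  qed
  note b = struve_damped_integral_upper[OF nu assms(2) \<gamma>]
  have J: "?J x < ?B3 x" if "x > 0" for x
    using struve_integral_upper(1)[OF n0 nu0 that] by simp
  show "(\<forall>x>0. ?I x < ?B x) \<and> best_upper_constant (<) ?I ?B"
    unfolding best_upper_constant_def B
  proof (intro conjI allI impI)
    fix x :: real assume x: "x > 0"
    have "?I x \<le> exp (- \<gamma> * x) / (1 - \<gamma>) * ?J x"
      using b(1,2)[of x] assms(2) x by (cases "\<gamma> = 0") (auto simp del: times_divide_eq_left)
    also have "\<dots> < exp (- \<gamma> * x) / (1 - \<gamma>) * ?B3 x"
      using \<gamma> by (intro mult_strict_left_mono J x) simp
    finally show "?I x < exp (- \<gamma> * x) / (1 - \<gamma>) * ?B3 x" .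
  next
    fix c :: real assume c: "0 < c \<and> c < 1"
    \<comment> \<open>The loss \<open>c\<close> is split evenly: one factor \<open>sqrt c\<close>
      goes to bound (3), which fails with it for all large \<open>x\<close>, the other to bound (4),
      which fails with it at some \<open>x\<close> beyond any given point.\<close>
    have c': "0 < sqrt c" "sqrt c < 1" "sqrt c * sqrt c = c" using c by auto
    have "\<forall>\<^sub>F x in at_top. sqrt c * ?B3 x < ?J x"
      using struve_integral_upper(2)[OF n0 nu0 zero_less_one c'(1,2)] by simp
    then obtain X where X: "\<And>x. x \<ge> X \<Longrightarrow> sqrt c * ?B3 x < ?J x"
      unfolding eventually_at_top_linorder by blast
    obtain x where x: "x > max 0 X" "sqrt c * (exp (- \<gamma> * x) / (1 - \<gamma>) * ?J x) < ?I x"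
      using b(3)[OF c'(1,2)] by blast
    have "sqrt c * (exp (- \<gamma> * x) / (1 - \<gamma>) * (sqrt c * ?B3 x))
        = sqrt c * sqrt c * (exp (- \<gamma> * x) / (1 - \<gamma>) * ?B3 x)"
      by (simp only: mult_ac)
    then have "c * (exp (- \<gamma> * x) / (1 - \<gamma>) * ?B3 x)
        = sqrt c * (exp (- \<gamma> * x) / (1 - \<gamma>) * (sqrt c * ?B3 x))"
      by (simp only: c'(3))
    also have "\<dots> \<le> sqrt c * (exp (- \<gamma> * x) / (1 - \<gamma>) * ?J x)"
      using \<gamma> c' x(1) by (intro mult_left_mono less_imp_le[OF X]) auto
    also note x(2)
    finally show "\<exists>x>0. \<not> ?I x < c * (exp (- \<gamma> * x) / (1 - \<gamma>) * ?B3 x)"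
      using x(1) by (intro exI[of _ x]) (auto simp: not_less less_imp_le)
  qed
next
  let ?I = "\<lambda>x. integral {0..x} (\<lambda>t. exp (- \<gamma> * t) * t powr (\<nu> + 1) * struve_L \<nu> t)"
  let ?B = "\<lambda>x. exp (- \<gamma> * x) * x powr (\<nu> + 1) * struve_L (\<nu> + 1) x"
  assume nu: "\<nu> > - 3 / 2"
  define g where "g = (\<lambda>x. x powr (\<nu> + 1) * struve_L (\<nu> + 1) x)"
  have J: "integral {0..x} (\<lambda>t. t powr (\<nu> + 1) * struve_L \<nu> t) = g x" if "x > 0" for x
    unfolding g_def by (rule struve_shifted_integral[OF nu that])
  have B: "?B x = exp (- \<gamma> * x) * g x" for x by (simp add: g_def mult.assoc)
  have nu': "\<nu> + 1 + \<nu> + 2 > 0" using nu by simp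
  note b = struve_damped_bounds[OF nu nu' assms(2), unfolded J]
  show "(\<forall>x>0. ?I x \<ge> ?B x \<and> (?I x = ?B x \<longleftrightarrow> \<gamma> = 0)) \<and> best_lower_constant (\<ge>) ?I ?B"
    unfolding best_lower_constant_def B
  proof (intro conjI[of "\<forall>x>0. ?I x \<ge> exp (- \<gamma> * x) * g x \<and> (?I x = exp (- \<gamma> * x) * g x \<longleftrightarrow> \<gamma> = 0)"]
      allI impI)
    fix x :: real assume x: "x > 0"
    show "?I x \<ge> exp (- \<gamma> * x) * g x \<and> (?I x = exp (- \<gamma> * x) * g x \<longleftrightarrow> \<gamma> = 0)"
    proof (cases "\<gamma> = 0")
      case True
      then show ?thesis using J[OF x] by simp
    next
      case False
      then show ?thesis using b(4)[OF x] assms(2) J[OF x] by simp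
    qed
  next
    fix c :: real assume c: "c > 1"
    \<comment> \<open>The witness is close to \<open>0\<close>: the integral is at most
      \<open>g x\<close>, which exceeds the lower bound only by the factor
      \<open>exp (\<gamma> * x)\<close>, and this tends to \<open>1\<close>.\<close>
    have "((\<lambda>x. exp (\<gamma> * x)) \<longlongrightarrow> exp (\<gamma> * 0)) (at_right 0)"
      by (intro tendsto_intros)
    then have "\<forall>\<^sub>F x in at_right 0. exp (\<gamma> * x) < c"
      by (rule order_tendstoD) (use c in simp)
    from eventually_happens'[OF trivial_limit_at_right_real eventually_conj[OF this eventually_at_right_less]]
    obtain x where x: "x > 0" "exp (\<gamma> * x) < c" by blast
    have "0 < g x" "?I x \<le> g x"
      using b(1,2)[OF x(1)] J[OF x(1)] by simp_all
    note this(2)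
    also have "g x = exp (\<gamma> * x) * (exp (- \<gamma> * x) * g x)"
      by (simp add: exp_minus)
    also have "\<dots> < c * (exp (- \<gamma> * x) * g x)"
      using x(2) \<open>0 < g x\<close> by (intro mult_strict_right_mono) auto
    finally show "\<exists>x>0. \<not> ?I x \<ge> c * (exp (- \<gamma> * x) * g x)"
      using x(1) by (intro exI[of _ x]) simp
  qed
next
  let ?I = "\<lambda>x. integral {0..x} (\<lambda>t. exp (- \<gamma> * t) * t powr (\<nu> + 1) * struve_L \<nu> t)"
  let ?B = "\<lambda>x. 1 / (1 - \<gamma>) * exp (- \<gamma> * x) * x powr (\<nu> + 1) * struve_L (\<nu> + 1) x"
  assume a: "\<gamma> < 1 \<and> \<nu> > - 1 / 2"
  then have nu: "\<nu> > - 1 / 2" and \<gamma>: "\<gamma> < 1" by auto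
  note b = struve_shifted_damped_upper[OF nu assms(2) \<gamma>]
  show "(\<forall>x>0. ?I x \<le> ?B x \<and> (\<gamma> > 0 \<longrightarrow> ?I x < ?B x)) \<and> best_upper_constant (\<le>) ?I ?B"
    unfolding best_upper_constant_def
  proof (intro conjI[of "\<forall>x>0. ?I x \<le> ?B x \<and> (\<gamma> > 0 \<longrightarrow> ?I x < ?B x)"] allI impI)
    fix x :: real assume "x > 0"
    then show "?I x \<le> ?B x \<and> (\<gamma> > 0 \<longrightarrow> ?I x < ?B x)"
      using b(1,2)[of x] assms(2) by (cases "\<gamma> = 0") (auto simp del: times_divide_eq_left)
  next
    fix c :: real assume "0 < c \<and> c < 1"
    then show "\<exists>x>0. \<not> ?I x \<le> c * ?B x"
      using b(3)[of c] unfolding not_le by blast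
  qed
qed

end
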